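(* Let $Q$ be a quadrangulation with $n$ squares, hence with $n-1$ inner edges, let $\sigma$ be a serpent nest in $Q$, and let $\overline{\sigma}$ be its dual. Then the rank of $\overline{\sigma}$ is $n-1-\operatorname{rk}(\sigma)$.
   Context: Quadrangulations. A quadrangulation is a set of pairwise noncrossing diagonals (inner edges) of a convex polygon with $2n+2$ vertices ($n\ge1$), cutting it into quadrilaterals (there are $n$ of them, called squares, and $n-1$ inner edges). Two squares are adjacent if they share an inner edge; with this adjacency the squares form a tree. Serpents. A serpent in $Q$ is a set of two distinct squares $\{s',s''\}$ (its extremities) such that the unique path of squares from $s'$ to $s''$ makes a right-angle turn in each intermediate square, i.e. never enters and leaves a square through opposite sides. The serpent is also identified with this path, drawn from the centre of $s'$ to the centre of $s''$. Serpent nests. A serpent nest in $Q$ is an equivalence class of sets of serpents in $Q$ satisfying the condition: two serpent extremities may lie in the same square only if the corresponding serpents do not leave this square by the same side. Two such sets are equivalent if the pattern of paths inside every square is the same for both: for each square and each of its four sides, the number of path segments going from this side to the centre (and stopping there) is the same, and for each square and each of its four pairs of adjacent sides, the number of path segments entering by one and leaving by the other is the same. The rank $\operatorname{rk}(\sigma)$ of a serpent nest $\sigma$ is the number of serpents in it (half the number of serpent extremities). Duality. The dual $\overline{\sigma}$ of a serpent nest $\sigma$ is the serpent nest whose pattern of paths is obtained from that of $\sigma$ by performing the following for every inner edge $e$ of $Q$, with $s$ and $s'$ the two squares adjacent to $e$: if both $s$ and $s'$ contain a serpent extremity leaving through $e$, remove both these extremities (the two segments from $e$ to the centres of $s$ and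 $s'$); if neither $s$ nor $s'$ contains a serpent extremity leaving through $e$, add both; otherwise (exactly one of them does) do nothing. In other words, all existing short serpents (serpents joining adjacent squares) are removed, and short serpents are introduced across every inner edge where no extremity leaves through that edge in either adjacent square. *)

theory Defs
  imports Main
begin

text \<open>
  Only the cyclic order of the vertices of a convex polygon matters for noncrossing diagonals, so
  the polygon with $2n+2$ vertices is modelled by the cyclically ordered vertices
  $0, \ldots, 2n+1$. Edges, cells (and in particular squares) are given by their vertex sets.
\<close>

type_synonym edge = "nat set"
type_synonym square = "nat set"
type_synonym serpent = "square set"
type_synonym serpent_nest = "serpent set set"

definition polygon_vertices :: "nat \<Rightarrow> nat set" where
  "polygon_vertices n = {..<2 * n + 2}"

definition boundary_edges :: "nat \<Rightarrow> edge set" where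
  "boundary_edges n = {{i, (i + 1) mod (2 * n + 2)} | i. i \<in> polygon_vertices n}"

definition diagonals :: "nat \<Rightarrow> edge set" where
  "diagonals n = {{i, j} | i j. i \<in> polygon_vertices n \<and> j \<in> polygon_vertices n \<and> i \<noteq> j}
     - boundary_edges n"

definition crossing :: "edge \<Rightarrow> edge \<Rightarrow> bool" where
  "crossing e f \<longleftrightarrow> (\<exists>a b c d. a < b \<and> b < c \<and> c < d \<and>
     ((e = {a, c} \<and> f = {b, d}) \<or> (e = {b, d} \<and> f = {a, c})))"

text \<open>The pairs of cyclically consecutive elements of \<open>F\<close>, i.e. the sides of the polygon with
  vertex set \<open>F\<close>; the second disjunct is the side joining the least to the greatest vertex.\<close>

definition sides :: "nat set \<Rightarrow> edge set" where
  "sides F = {{a, b} | a b. a \<in> F \<and> b \<in> F \<and> a < b \<and> (F \<inter> {a<..<b} = {} \<or> F \<subseteq> {a..b})}"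

text \<open>For noncrossing \<open>Q\<close>, these are the pieces into which \<open>Q\<close> cuts the polygon: subpolygons
  bounded by polygon edges and diagonals of \<open>Q\<close> that are not cut further. A diagonal meeting the
  interior of such a subpolygon would cross a side or join two of its vertices, so it suffices
  to exclude the latter.\<close>

definition cells :: "nat \<Rightarrow> edge set \<Rightarrow> nat set set" where
  "cells n Q = {F. F \<subseteq> polygon_vertices n \<and> card F \<ge> 3 \<and>
     sides F \<subseteq> boundary_edges n \<union> Q \<and> (\<forall>e\<in>Q. e \<subseteq> F \<longrightarrow> e \<in> sides F)}"

definition quadrangulation :: "nat \<Rightarrow> edge set \<Rightarrow> bool" where
  "quadrangulation n Q \<longleftrightarrow> n \<ge> 1 \<and> Q \<subseteq> diagonals n \<and>
     (\<forall>e\<in>Q. \<forall>f\<in>Q. \<not> crossing e f) \<and> (\<forall>F\<in>cells n Q. card F = 4)"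

abbreviation squares :: "nat \<Rightarrow> edge set \<Rightarrow> square set" where
  "squares \<equiv> cells"

definition adjacent_via :: "nat \<Rightarrow> edge set \<Rightarrow> edge \<Rightarrow> square \<Rightarrow> square \<Rightarrow> bool" where
  "adjacent_via n Q e s t \<longleftrightarrow> s \<in> squares n Q \<and> t \<in> squares n Q \<and> s \<noteq> t \<and>
     e \<in> Q \<and> e \<in> sides s \<and> e \<in> sides t"

definition adjacent :: "nat \<Rightarrow> edge set \<Rightarrow> square \<Rightarrow> square \<Rightarrow> bool" where
  "adjacent n Q s t \<longleftrightarrow> (\<exists>e. adjacent_via n Q e s t)"

definition shared_edge :: "nat \<Rightarrow> edge set \<Rightarrow> square \<Rightarrow> square \<Rightarrow> edge" where
  "shared_edge n Q s t = (THE e. adjacent_via n Q e s t)"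

definition square_path :: "nat \<Rightarrow> edge set \<Rightarrow> square list \<Rightarrow> bool" where
  "square_path n Q xs \<longleftrightarrow> xs \<noteq> [] \<and> distinct xs \<and> set xs \<subseteq> squares n Q \<and>
     (\<forall>i. i + 1 < length xs \<longrightarrow> adjacent n Q (xs ! i) (xs ! (i + 1)))"

text \<open>The squares form a tree, so there is exactly one such path.\<close>

definition route :: "nat \<Rightarrow> edge set \<Rightarrow> square \<Rightarrow> square \<Rightarrow> square list" where
  "route n Q s t = (THE xs. square_path n Q xs \<and> hd xs = s \<and> last xs = t)"

text \<open>Two distinct sides of a square are opposite if they are disjoint and adjacent if they
  share a vertex.\<close>

definition opposite_sides :: "square \<Rightarrow> edge \<Rightarrow> edge \<Rightarrow> bool" where
  "opposite_sides s e f \<longleftrightarrow> e \<in> sides s \<and> f \<in> sides s \<and> e \<inter> f = {}"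

definition adjacent_sides :: "square \<Rightarrow> edge \<Rightarrow> edge \<Rightarrow> bool" where
  "adjacent_sides s e f \<longleftrightarrow> e \<in> sides s \<and> f \<in> sides s \<and> e \<noteq> f \<and> e \<inter> f \<noteq> {}"

definition serpent :: "nat \<Rightarrow> edge set \<Rightarrow> serpent \<Rightarrow> bool" where
  "serpent n Q p \<longleftrightarrow> (\<exists>s t. p = {s, t} \<and> s \<noteq> t \<and> s \<in> squares n Q \<and> t \<in> squares n Q \<and>
     (let xs = route n Q s t in
      \<forall>i. i + 2 < length xs \<longrightarrow>
        \<not> opposite_sides (xs ! (i + 1))
            (shared_edge n Q (xs ! i) (xs ! (i + 1)))
            (shared_edge n Q (xs ! (i + 1)) (xs ! (i + 2)))))"

text \<open>The serpent \<open>p\<close> has an extremity in the square \<open>s\<close>, which it leaves through the side \<open>e\<close>.\<close>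

definition extremity :: "nat \<Rightarrow> edge set \<Rightarrow> serpent \<Rightarrow> square \<Rightarrow> edge \<Rightarrow> bool" where
  "extremity n Q p s e \<longleftrightarrow> (\<exists>t. p = {s, t} \<and> s \<noteq> t \<and> e = shared_edge n Q s (route n Q s t ! 1))"

text \<open>The serpent \<open>p\<close> crosses the square \<open>s\<close>, entering by one of \<open>e\<close>, \<open>f\<close> and leaving by the
  other one.\<close>

definition passes :: "nat \<Rightarrow> edge set \<Rightarrow> serpent \<Rightarrow> square \<Rightarrow> edge \<Rightarrow> edge \<Rightarrow> bool" where
  "passes n Q p s e f \<longleftrightarrow> (\<exists>s' t'. p = {s', t'} \<and> s' \<noteq> t' \<and>
     (let xs = route n Q s' t' in
      \<exists>i. i + 2 < length xs \<and> xs ! (i + 1) = s \<and>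
        {e, f} = {shared_edge n Q (xs ! i) s, shared_edge n Q s (xs ! (i + 2))}))"

definition nest_sets :: "nat \<Rightarrow> edge set \<Rightarrow> serpent set set" where
  "nest_sets n Q = {S. (\<forall>p\<in>S. serpent n Q p) \<and>
     (\<forall>p\<in>S. \<forall>q\<in>S. \<forall>s e. p \<noteq> q \<longrightarrow> \<not> (extremity n Q p s e \<and> extremity n Q q s e))}"

definition stops :: "nat \<Rightarrow> edge set \<Rightarrow> serpent set \<Rightarrow> square \<Rightarrow> edge \<Rightarrow> nat" where
  "stops n Q S s e = card {p \<in> S. extremity n Q p s e}"

definition turns :: "nat \<Rightarrow> edge set \<Rightarrow> serpent set \<Rightarrow> square \<Rightarrow> edge \<Rightarrow> edge \<Rightarrow> nat" where
  "turns n Q S s e f = card {p \<in> S. passes n Q p s e f}"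

definition same_pattern :: "nat \<Rightarrow> edge set \<Rightarrow> (serpent set \<times> serpent set) set" where
  "same_pattern n Q = {(S, T). S \<in> nest_sets n Q \<and> T \<in> nest_sets n Q \<and>
     (\<forall>s\<in>squares n Q.
        (\<forall>e\<in>sides s. stops n Q S s e = stops n Q T s e) \<and>
        (\<forall>e f. adjacent_sides s e f \<longrightarrow> turns n Q S s e f = turns n Q T s e f))}"

definition serpent_nests :: "nat \<Rightarrow> edge set \<Rightarrow> serpent_nest set" where
  "serpent_nests n Q = nest_sets n Q // same_pattern n Q"

text \<open>All sets in a serpent nest have the same number of serpents.\<close>

definition nest_rank :: "serpent_nest \<Rightarrow> nat" where
  "nest_rank \<sigma> = the_elem (card ` \<sigma>)"

text \<open>The pattern of \<open>T\<close> is obtained from that of \<open>S\<close> by the duality rule. The condition on inner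
  edges holds for both orders of the two squares, so it describes the change on both sides
  of \<open>e\<close>.\<close>

definition dual_pattern :: "nat \<Rightarrow> edge set \<Rightarrow> serpent set \<Rightarrow> serpent set \<Rightarrow> bool" where
  "dual_pattern n Q S T \<longleftrightarrow>
     (\<forall>e s s'. adjacent_via n Q e s s' \<longrightarrow>
        stops n Q T s e =
          (if stops n Q S s e > 0 \<and> stops n Q S s' e > 0 then stops n Q S s e - 1
           else if stops n Q S s e = 0 \<and> stops n Q S s' e = 0 then stops n Q S s e + 1
           else stops n Q S s e)) \<and>
     (\<forall>s\<in>squares n Q.
        (\<forall>e\<in>sides s - Q. stops n Q T s e = stops n Q S s e) \<and>
        (\<forall>e f. adjacent_sides s e f \<longrightarrow> turns n Q T s e f = turns n Q S s e f))"

text \<open>The class of all sets of serpents having the pattern prescribed by duality. It is a serpent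
  nest as soon as it is nonempty.\<close>

definition nest_dual :: "nat \<Rightarrow> edge set \<Rightarrow> serpent_nest \<Rightarrow> serpent_nest" where
  "nest_dual n Q \<sigma> = {T \<in> nest_sets n Q. \<exists>S\<in>\<sigma>. dual_pattern n Q S T}"

end

theory Submission
  imports Defs
begin

text \<open>
  Fix a quadrangulation \<open>Q\<close>. The geometry enters only through the two parts into which an inner edge
  divides the polygon. Every square lies on one part of every inner edge (\<open>cell_one_side\<close>), and two
  different squares are always separated by some side of the first one (\<open>separating_side\<close>). Hence at
  most one square on either part is incident to an inner edge. Both exist (\<open>cell_below_exists\<close>,
  \<open>cell_above_exists\<close>), and moving between them changes the part with respect to that edge only. A path without repetition from \<open>s\<close> to \<open>t\<close> therefore
  crosses exactly the inner edges that separate \<open>s\<close> from \<open>t\<close>, each of them once; such a path exists and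
  is unique. The numbers of squares and of inner edges are obtained by double counting their incidences
  after rooting the tree of squares at a boundary edge (\<open>card_squares_card_Q\<close>).

  A serpent is thus a pair \<open>p\<close> of squares whose set \<open>cuts p\<close> of separating edges contains no two
  opposite sides of a square. Its extremities and turns can be read off from \<open>cuts p\<close>
  (\<open>extremity_iff\<close>, \<open>passes_iff\<close>, \<open>serpent_iff\<close>), which replaces arguments about paths by arguments
  about sets of edges.

  That the dual pattern is realized by a set of serpents is the substantial part. The duality rule
  acts on each inner edge \<open>e\<close> independently, so it is enough to apply it at one edge
  (\<open>dualize_edge\<close>). If neither of the two squares \<open>s\<close>, \<open>s'\<close> at \<open>e\<close> has an extremity leaving through
  \<open>e\<close>, a short serpent is added. If both have one, they either belong to the short serpent \<open>{s, s'}\<close>,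
  which is deleted, or to two serpents \<open>{s, t}\<close> and \<open>{s', u}\<close> that overlap in \<open>e\<close>, and these are
  replaced by the single serpent \<open>{u, t}\<close> (\<open>merge_serpents\<close>).

  The rank formula is a count of extremities. A set of serpents has twice as many extremities as
  serpents, and at each of the \<open>n - 1\<close> inner edges a nest and its dual have exactly two extremities
  together, because the rule turns \<open>k\<close> extremities into \<open>2 - k\<close>.
\<close>

section \<open>Sides of vertex sets\<close>

text \<open>
  In the cyclic order, the elements of \<open>F\<close> cut the remaining vertices into arcs, and the two ends
  of the arc that contains \<open>z\<close> form a side of \<open>F\<close>. The second alternative is the arc that wraps
  around past the greatest vertex.
\<close>

lemma finite_gap_side:
  fixes F :: "nat set"
  assumes "finite F" "card F \<ge> 2" "z \<notin> F"
  obtains c d where "c \<in> F" "d \<in> F" "c < d" "{c, d} \<in> sides F"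
    "c < z \<and> z < d \<and> F \<inter> {c<..<d} = {} \<or> F \<subseteq> {c..d} \<and> (z < c \<or> d < z)"
proof (cases "(\<exists>v\<in>F. v < z) \<and> (\<exists>v\<in>F. z < v)")
  case True
  define c where "c = Max {v \<in> F. v < z}"
  define d where "d = Min {v \<in> F. z < v}"
  have c: "c \<in> {v \<in> F. v < z}" unfolding c_def
    by (rule Max_in) (use True \<open>finite F\<close> in auto)
  have d: "d \<in> {v \<in> F. z < v}" unfolding d_def
    by (rule Min_in) (use True \<open>finite F\<close> in auto)
  have "v \<le> c" if "v \<in> F" "v < z" for v
    unfolding c_def by (rule Max_ge) (use that \<open>finite F\<close> in auto)
  moreover have "d \<le> v" if "v \<in> F" "z < v" for v
    unfolding d_def by (rule Min_le) (use that \<open>finite F\<close> in auto)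
  ultimately have gap: "F \<inter> {c<..<d} = {}"
    using \<open>z \<notin> F\<close> by (fastforce simp: set_eq_iff not_less dest: nat_neq_iff[THEN iffD1])
  have "{c, d} \<in> sides F" using c d gap unfolding sides_def by fastforce
  then show ?thesis using that[of c d] c d gap by auto
next
  case False
  define c where "c = Min F"
  define d where "d = Max F"
  have ne: "F \<noteq> {}" using assms(2) by auto
  have cd: "c \<in> F" "d \<in> F" "F \<subseteq> {c..d}"
    unfolding c_def d_def using \<open>finite F\<close> ne by auto
  have "c < d"
  proof (rule ccontr)
    assume "\<not> c < d"
    then have "F \<subseteq> {c}" using cd by auto
    then have "card F \<le> card {c}" by (intro card_mono) auto
    then show False using assms(2) by simp
  qed
  have "z < c \<or> d < z" using False cd assms(3) by (metis linorder_neqE_nat)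
  moreover have "{c, d} \<in> sides F" using cd \<open>c < d\<close> unfolding sides_def by blast
  ultimately show ?thesis using that[of c d] cd \<open>c < d\<close> by auto
qed

text \<open>
  An edge divides the polygon into the part spanned by the vertices between its ends, called the
  part below it, and the rest. A square never meets both parts in its interior, so for squares the
  negation of \<open>below\<close> says that the square lies on the far part.
\<close>

definition below :: "edge \<Rightarrow> nat set \<Rightarrow> bool" where
  "below e F \<longleftrightarrow> F \<subseteq> {Min e..Max e}"

lemma below_doubleton: "a < b \<Longrightarrow> below {a, b} F \<longleftrightarrow> F \<subseteq> {a..b}"
  by (auto simp: below_def)

lemma sides_doubletonD:
  "a < b \<Longrightarrow> {a, b} \<in> sides F \<Longrightarrow>
    a \<in> F \<and> b \<in> F \<and> (F \<inter> {a<..<b} = {} \<or> F \<subseteq> {a..b})"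
  by (auto simp: sides_def doubleton_eq_iff)

lemma sides_doubletonI:
  "a < b \<Longrightarrow> a \<in> F \<Longrightarrow> b \<in> F \<Longrightarrow> F \<inter> {a<..<b} = {} \<or> F \<subseteq> {a..b} \<Longrightarrow>
    {a, b} \<in> sides F"
  unfolding sides_def by blast

lemma sidesE:
  assumes "e \<in> sides F"
  obtains a b where "e = {a, b}" "a < b" "a \<in> F" "b \<in> F" "F \<inter> {a<..<b} = {} \<or> F \<subseteq> {a..b}"
  using assms unfolding sides_def by blast

lemma card_side: "e \<in> sides F \<Longrightarrow> card e = 2"
  by (auto simp: sides_def)

lemma side_subset: "e \<in> sides F \<Longrightarrow> e \<subseteq> F"
  by (auto simp: sides_def)

lemma boundary_edge_cases:
  assumes "e \<in> boundary_edges n"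
  obtains i where "i < 2 * n + 1" "e = {i, Suc i}" | "e = {0, 2 * n + 1}"
proof -
  obtain i where i: "i < 2 * n + 2" "e = {i, (i + 1) mod (2 * n + 2)}"
    using assms by (auto simp: boundary_edges_def polygon_vertices_def)
  show ?thesis
  proof (cases "i < 2 * n + 1")
    case True
    then show ?thesis using i that(1)[of i] by simp
  next
    case False
    then have "i = 2 * n + 1" using i by simp
    then show ?thesis using i that(2) by (simp add: insert_commute)
  qed
qed

lemma root_edge_boundary: "{0, 2 * n + 1} \<in> boundary_edges n"
  unfolding boundary_edges_def polygon_vertices_def
  by (intro CollectI exI[of _ "2 * n + 1"]) auto

lemma short_edge_boundary: "i < 2 * n + 1 \<Longrightarrow> {i, Suc i} \<in> boundary_edges n"
  unfolding boundary_edges_def polygon_vertices_def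
  by (intro CollectI exI[of _ i]) auto

lemma boundary_edges_eq:
  "boundary_edges n = insert {0, 2 * n + 1} ((\<lambda>i. {i, Suc i}) ` {..<2 * n + 1})"
proof
  show "boundary_edges n \<subseteq> insert {0, 2 * n + 1} ((\<lambda>i. {i, Suc i}) ` {..<2 * n + 1})"
  proof
    fix e assume "e \<in> boundary_edges n"
    then show "e \<in> insert {0, 2 * n + 1} ((\<lambda>i. {i, Suc i}) ` {..<2 * n + 1})"
      by (cases rule: boundary_edge_cases) blast+
  qed
  show "insert {0, 2 * n + 1} ((\<lambda>i. {i, Suc i}) ` {..<2 * n + 1}) \<subseteq> boundary_edges n"
    using root_edge_boundary[of n] short_edge_boundary[of _ n] by blast
qed

lemma boundary_edge_ordered:
  assumes "{a, b} \<in> boundary_edges n" "a < b"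
  shows "a = 0 \<and> b = 2 * n + 1 \<or> b = Suc a"
  using assms by (auto simp: boundary_edges_eq doubleton_eq_iff)

lemma card_boundary_edges:
  assumes "n \<ge> 1"
  shows "card (boundary_edges n) = 2 * n + 2" "finite (boundary_edges n)"
proof -
  have "inj_on (\<lambda>i::nat. {i, Suc i}) {..<2 * n + 1}"
    by (auto simp: inj_on_def doubleton_eq_iff)
  then have "card ((\<lambda>i::nat. {i, Suc i}) ` {..<2 * n + 1}) = 2 * n + 1"
    by (simp add: card_image)
  moreover have "{0, 2 * n + 1} \<notin> (\<lambda>i. {i, Suc i}) ` {..<2 * n + 1}"
    using assms by (auto simp: doubleton_eq_iff)
  ultimately show "card (boundary_edges n) = 2 * n + 2" "finite (boundary_edges n)"
    unfolding boundary_edges_eq by simp_all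
qed

text \<open>
  Four vertices \<open>w < x < y < z\<close> have the sides \<open>wx\<close>, \<open>xy\<close>, \<open>yz\<close>, \<open>wz\<close>; the two remaining pairs
  have a vertex on either side of them.
\<close>

lemma card_sides_four:
  assumes "card F = 4"
  shows "card (sides F) = 4" "finite (sides F)"
proof -
  have fin: "finite F" using assms by (metis card.infinite zero_neq_numeral)
  have len: "length (sorted_list_of_set F) = 4" using assms by simp
  then obtain w x y z where l: "sorted_list_of_set F = [w, x, y, z]"
    by (auto simp: length_Suc_conv eval_nat_numeral simp del: length_sorted_list_of_set)
  have "sorted_wrt (<) [w, x, y, z]" unfolding l[symmetric] by (rule strict_sorted_list_of_set)
  then have o: "w < x" "x < y" "y < z" by auto
  have F: "F = {w, x, y, z}" using set_sorted_list_of_set[OF fin] l by auto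
  have "sides F = {{w, x}, {x, y}, {y, z}, {w, z}}"
  proof
    show "sides F \<subseteq> {{w, x}, {x, y}, {y, z}, {w, z}}"
    proof
      fix e assume "e \<in> sides F"
      then obtain a b where e: "e = {a, b}" "a < b" "a \<in> F" "b \<in> F"
        and "F \<inter> {a<..<b} = {} \<or> F \<subseteq> {a..b}" by (rule sidesE)
      from this(5) have "\<not> (a = w \<and> b = y)" "\<not> (a = x \<and> b = z)" using o F by auto
      moreover have "a = w \<or> a = x \<or> a = y \<or> a = z" "b = w \<or> b = x \<or> b = y \<or> b = z"
        using e(3,4) by (simp_all add: F)
      ultimately have "a = w \<and> b = x \<or> a = w \<and> b = z \<or> a = x \<and> b = y \<or> a = y \<and> b = z"
        using e(2) o by (elim disjE) simp_all
      then show "e \<in> {{w, x}, {x, y}, {y, z}, {w, z}}" unfolding e(1) by blast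
    qed
    have "F \<inter> {w<..<x} = {}" "F \<inter> {x<..<y} = {}" "F \<inter> {y<..<z} = {}" "F \<subseteq> {w..z}"
      using o by (auto simp: F)
    then show "{{w, x}, {x, y}, {y, z}, {w, z}} \<subseteq> sides F"
      using sides_doubletonI[of w x F] sides_doubletonI[of x y F] sides_doubletonI[of y z F]
        sides_doubletonI[of w z F] o by (simp add: F)
  qed
  then show "card (sides F) = 4" "finite (sides F)" using o by (simp_all add: doubleton_eq_iff card_insert_if)
qed

section \<open>Squares lie on one side of every inner edge\<close>

locale polygon_quadrangulation =
  fixes n :: nat and Q :: "edge set"
  assumes quad: "quadrangulation n Q"
begin

abbreviation "root \<equiv> {0, 2 * n + 1}"

lemma n_pos: "n \<ge> 1" and Q_diagonals: "Q \<subseteq> diagonals n"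
  and card_square: "F \<in> squares n Q \<Longrightarrow> card F = 4"
  using quad by (auto simp: quadrangulation_def)

lemma not_crossing: "e \<in> Q \<Longrightarrow> f \<in> Q \<Longrightarrow> \<not> crossing e f"
  using quad unfolding quadrangulation_def by blast

lemma diagonal_not_boundary: "e \<in> Q \<Longrightarrow> e \<notin> boundary_edges n"
  using Q_diagonals by (auto simp: diagonals_def)

lemma diagonalE:
  assumes "e \<in> Q"
  obtains a b where "e = {a, b}" "a < b" "b < 2 * n + 2"
proof -
  obtain i j where "e = {i, j}" "i < 2 * n + 2" "j < 2 * n + 2" "i \<noteq> j"
    using assms Q_diagonals by (auto simp: diagonals_def polygon_vertices_def)
  then show ?thesis using that[of i j] that[of j i] by (cases "i < j") (auto simp: insert_commute)
qed

lemma edge_bound: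
  assumes "{a, b} \<in> Q \<union> boundary_edges n" "a < b"
  shows "b < 2 * n + 2"
  using assms(1)
proof
  assume "{a, b} \<in> Q"
  then obtain c d where "{a, b} = {c, d}" "c < d" "d < 2 * n + 2" by (rule diagonalE)
  then show ?thesis using assms(2) by (auto simp: doubleton_eq_iff)
next
  assume "{a, b} \<in> boundary_edges n"
  then obtain i where "i < 2 * n + 2" "{a, b} = {i, (i + 1) mod (2 * n + 2)}"
    by (auto simp: boundary_edges_def polygon_vertices_def)
  moreover have "(i + 1) mod (2 * n + 2) < 2 * n + 2" by simp
  ultimately show ?thesis by (metis doubleton_eq_iff)
qed

text \<open>
  Edges with interleaving ends cross. Boundary edges are covered as well: no vertex lies strictly
  between the ends of \<open>{i, i + 1}\<close>, and no vertex of the polygon lies outside \<open>{0, \<dots>, 2 n + 1}\<close>.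
\<close>

lemma edge_interleave:
  assumes "{a, b} \<in> Q \<union> boundary_edges n" "{c, d} \<in> Q \<union> boundary_edges n"
    "b < 2 * n + 2" "d < 2 * n + 2" "a < c" "c < b" "b < d"
  shows False
proof -
  have "crossing {a, b} {c, d}" unfolding crossing_def using assms(5-7) by blast
  moreover have "{a, b} \<notin> boundary_edges n" "{c, d} \<notin> boundary_edges n"
    using boundary_edge_ordered[of a b n] boundary_edge_ordered[of c d n] assms(3-7) by auto
  ultimately show False using not_crossing assms(1,2) by blast
qed

lemma cellD:
  assumes "F \<in> squares n Q"
  shows "finite F" "v \<in> F \<Longrightarrow> v < 2 * n + 2" "card F = 4" "e \<in> sides F \<Longrightarrow> e \<in> Q \<union> boundary_edges n"
    "e \<in> Q \<Longrightarrow> e \<subseteq> F \<Longrightarrow> e \<in> sides F"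
  using assms card_square[OF assms]
  by (auto simp: cells_def polygon_vertices_def intro: finite_subset)

lemma cell_not_subset_doubleton: "F \<in> squares n Q \<Longrightarrow> \<not> F \<subseteq> {a, b}"
  using cellD(3)[of F] card_mono[of "{a, b}" F] by (auto simp: card_insert_if split: if_splits)

text \<open>
  If \<open>F\<close> had vertices on both parts and missed an end of \<open>{a, b}\<close>, then the side of \<open>F\<close> that jumps
  over this end would cross \<open>{a, b}\<close>. So both ends belong to \<open>F\<close>; then \<open>{a, b}\<close> is a side of \<open>F\<close>
  by the definition of cells, and a side has all of \<open>F\<close> on one part.
\<close>

lemma cell_one_side:
  assumes F: "F \<in> squares n Q" and e: "{a, b} \<in> Q" and ab: "a < b"
  shows "F \<subseteq> {a..b} \<or> F \<inter> {a<..<b} = {}"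
proof (rule ccontr)
  assume "\<not> ?thesis"
  then have "\<exists>x\<in>F. a < x \<and> x < b" "\<exists>y\<in>F. y \<notin> {a..b}" by auto
  then obtain x y where x: "x \<in> F" "a < x" "x < b" and y: "y \<in> F" "y \<notin> {a..b}" by blast
  have b: "b < 2 * n + 2" using edge_bound[OF _ ab] e by blast
  have card2: "card F \<ge> 2" using cellD(3)[OF F] by simp
  have nocross: "\<not> (a < c \<and> c < b \<and> b < d)" "\<not> (c < a \<and> a < d \<and> d < b)"
    if "{c, d} \<in> sides F" "d \<in> F" for c d
    using edge_interleave[of a b c d] edge_interleave[of c d a b] e b
      cellD(4)[OF F that(1)] cellD(2)[OF F that(2)] by auto
  have "a \<in> F"
  proof (rule ccontr)
    assume "a \<notin> F"
    then obtain c d where cd: "c \<in> F" "d \<in> F" "c < d" "{c, d} \<in> sides F"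
      "c < a \<and> a < d \<and> F \<inter> {c<..<d} = {} \<or> F \<subseteq> {c..d} \<and> (a < c \<or> d < a)"
      using finite_gap_side cellD(1)[OF F] card2 by metis
    from cd(5) show False
    proof
      assume *: "c < a \<and> a < d \<and> F \<inter> {c<..<d} = {}"
      then have "\<not> (c < x \<and> x < d)" using x(1) by auto
      then show False using * x(2,3) nocross[OF cd(4,2)] by linarith
    next
      assume *: "F \<subseteq> {c..d} \<and> (a < c \<or> d < a)"
      then have "c \<le> x" "x \<le> d" "c \<le> y" "y \<le> d" using x(1) y(1) by auto
      then show False using * x(2,3) y(2) nocross[OF cd(4,2)] by auto
    qed
  qed
  moreover have "b \<in> F"
  proof (rule ccontr)
    assume "b \<notin> F"
    then obtain c d where cd: "c \<in> F" "d \<in> F" "c < d" "{c, d} \<in> sides F"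
      "c < b \<and> b < d \<and> F \<inter> {c<..<d} = {} \<or> F \<subseteq> {c..d} \<and> (b < c \<or> d < b)"
      using finite_gap_side cellD(1)[OF F] card2 by metis
    from cd(5) show False
    proof
      assume *: "c < b \<and> b < d \<and> F \<inter> {c<..<d} = {}"
      then have "\<not> (c < x \<and> x < d)" using x(1) by auto
      then show False using * x(2,3) nocross[OF cd(4,2)] by linarith
    next
      assume *: "F \<subseteq> {c..d} \<and> (b < c \<or> d < b)"
      then have "c \<le> x" "x \<le> d" "c \<le> y" "y \<le> d" using x(1) y(1) by auto
      then show False using * x(2,3) y(2) nocross[OF cd(4,2)] by auto
    qed
  qed
  ultimately have "{a, b} \<in> sides F" using cellD(5)[OF F e] by simp
  from sides_doubletonD[OF ab this] x y show False by auto
qed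

lemma below_differ_inter:
  assumes "F \<in> squares n Q" "G \<in> squares n Q" "e \<in> Q" "below e F \<noteq> below e G"
  shows "F \<inter> G \<subseteq> e"
proof -
  obtain a b where e: "e = {a, b}" "a < b" using diagonalE[OF assms(3)] by metis
  show ?thesis
    using cell_one_side[OF assms(1), of a b] cell_one_side[OF assms(2), of a b] assms(3,4)
    unfolding e(1) below_doubleton[OF e(2)] using e by fastforce
qed

text \<open>
  The tree structure of the squares rests on this lemma. A vertex \<open>x\<close> of \<open>G\<close> that is not in
  \<open>F\<close> lies in a gap between two cyclically consecutive vertices of \<open>F\<close>. The side of \<open>F\<close> that closes
  the gap has a vertex beyond it, so it is a diagonal, and \<open>G\<close> lies beyond it because \<open>x\<close> does.
\<close>

lemma separating_side:
  assumes F: "F \<in> squares n Q" and G: "G \<in> squares n Q" and ne: "F \<noteq> G"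
  obtains e where "e \<in> Q" "e \<in> sides F" "below e F \<noteq> below e G"
proof -
  have "\<not> G \<subseteq> F" using card_subset_eq[of F G] cellD[OF F] cellD[OF G] ne by auto
  then obtain x where x: "x \<in> G" "x \<notin> F" by blast
  obtain c d where cd: "c \<in> F" "d \<in> F" "c < d" "{c, d} \<in> sides F"
      "c < x \<and> x < d \<and> F \<inter> {c<..<d} = {} \<or> F \<subseteq> {c..d} \<and> (x < c \<or> d < x)"
    using finite_gap_side[OF cellD(1)[OF F] _ x(2)] cellD(3)[OF F] by auto
  have "{c, d} \<notin> boundary_edges n"
  proof
    assume "{c, d} \<in> boundary_edges n"
    then show False
    proof (cases rule: boundary_edge_cases)
      case (1 i)
      then have "c = i" "d = Suc i" using cd(3) by (auto simp: doubleton_eq_iff)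
      with cd have "F \<subseteq> {i..Suc i}" by auto
      then have "F \<subseteq> {i, Suc i}" by (simp add: atLeastAtMostSuc_conv insert_commute)
      then show False using cell_not_subset_doubleton[OF F] by blast
    next
      case 2
      then have eq: "c = 0" "d = 2 * n + 1" using cd(3) by (auto simp: doubleton_eq_iff)
      have "v < 2 * n + 2" if "v \<in> F \<union> G" for v using that cellD(2)[OF F] cellD(2)[OF G] by blast
      with cd x eq have gap: "F \<inter> {0<..<2 * n + 1} = {}" "\<And>v. v \<in> F \<Longrightarrow> v \<le> 2 * n + 1"
        by fastforce+
      have "F \<subseteq> {0, 2 * n + 1}"
      proof
        fix v assume "v \<in> F"
        then show "v \<in> {0, 2 * n + 1}" using gap(1) gap(2)[of v] by (cases "v = 0") auto
      qed
      then show False using cell_not_subset_doubleton[OF F] by blast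
    qed
  qed
  then have Q: "{c, d} \<in> Q" using cellD(4)[OF F cd(4)] by blast
  from cd(5) have "below {c, d} F \<noteq> below {c, d} G"
  proof
    assume *: "c < x \<and> x < d \<and> F \<inter> {c<..<d} = {}"
    then have "G \<subseteq> {c..d}" using cell_one_side[OF G Q cd(3)] x by auto
    moreover have "\<not> F \<subseteq> {c..d}"
    proof
      assume "F \<subseteq> {c..d}"
      then have "F \<subseteq> {c, d}" using * by fastforce
      then show False using cell_not_subset_doubleton[OF F] by blast
    qed
    ultimately show ?thesis using cd(3) by (simp add: below_doubleton)
  next
    assume "F \<subseteq> {c..d} \<and> (x < c \<or> d < x)"
    then show ?thesis using cd(3) x by (auto simp: below_doubleton)
  qed
  then show ?thesis using that Q cd(4) by blast
qed

text \<open>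
  Squares on different parts of an inner edge \<open>g\<close> share at most the ends of \<open>g\<close>. So a side \<open>g\<close> of \<open>F\<close>
  separating \<open>F\<close> from \<open>G\<close> can only be \<open>e\<close>, which has both on the same part.
\<close>

lemma cell_unique:
  assumes F: "F \<in> squares n Q" and G: "G \<in> squares n Q" and e: "card e = 2" "e \<subseteq> F" "e \<subseteq> G"
    and same: "below e F = below e G"
  shows "F = G"
proof (rule ccontr)
  assume "F \<noteq> G"
  then obtain g where g: "g \<in> Q" "g \<in> sides F" "below g F \<noteq> below g G"
    using separating_side[OF F G] by metis
  have "e \<subseteq> g" using below_differ_inter[OF F G g(1,3)] e by blast
  then have "e = g" using e(1) card_side[OF g(2)] card_subset_eq[of g e]
    by (metis card.infinite zero_neq_numeral)
  then show False using same g by simp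
qed

section \<open>Squares on both parts of an edge\<close>

text \<open>
  The square below \<open>{a, b}\<close> consists of the vertices between \<open>a\<close> and \<open>b\<close> that are visible from
  \<open>{a, b}\<close>, that is, not hidden below another diagonal that lies below \<open>{a, b}\<close>.
\<close>

lemma cell_below_exists:
  assumes e: "{a, b} \<in> insert root Q" and ab: "a < b"
  defines "F \<equiv> {v \<in> {a..b}. \<forall>x y. {x, y} \<in> Q \<longrightarrow> a \<le> x \<longrightarrow> x < v \<longrightarrow> v < y \<longrightarrow> y \<le> b \<longrightarrow> x = a \<and> y = b}"
  shows "F \<in> squares n Q" "a \<in> F" "b \<in> F" "F \<subseteq> {a..b}"
proof -
  have eB: "{a, b} \<in> Q \<union> boundary_edges n" using e root_edge_boundary by auto
  have bV: "b < 2 * n + 2"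
    using edge_bound[OF eB ab] .
  show ab_in: "a \<in> F" "b \<in> F" and sub: "F \<subseteq> {a..b}" using ab by (auto simp: F_def)
  have finF: "finite F" using sub finite_subset by blast
  have not2: "a + 1 < b"
  proof (rule ccontr)
    assume "\<not> a + 1 < b"
    then have "b = Suc a" using ab by simp
    then have "{a, b} \<in> boundary_edges n" "{a, b} \<noteq> root"
      using short_edge_boundary[of a n] bV n_pos by (auto simp: doubleton_eq_iff)
    then show False using e diagonal_not_boundary by auto
  qed
  have consecutive: "{c, d} \<in> Q \<union> boundary_edges n \<and> \<not> (c = a \<and> d = b)"
    if cd: "c \<in> F" "d \<in> F" "c < d" and gap: "F \<inter> {c<..<d} = {}" for c d
  proof (cases "d = Suc c")
    case True
    then show ?thesis using short_edge_boundary[of c n] cd sub bV not2 by fastforce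
  next
    case False
    \<comment> \<open>The far ends of the diagonals between \<open>c\<close> and \<open>d\<close> that start at \<open>c\<close>. One of
      them hides \<open>Suc c\<close>, and if one ends before \<open>d\<close>, its far end is hidden by a longer one. So the
      longest one ends at \<open>d\<close>.\<close>
    let ?Y = "{y. {c, y} \<in> Q \<and> c < y \<and> y \<le> d \<and> \<not> (c = a \<and> y = b)}"
    have cover: "\<exists>y. y \<in> ?Y \<and> v < y" if v: "c < v" "v < d" and w: "v = Suc c \<or> v \<in> ?Y" for v
    proof -
      have "v \<notin> F" using gap v by auto
      moreover have "v \<in> {a..b}" using v cd sub by auto
      ultimately obtain x y
        where xy: "{x, y} \<in> Q" "a \<le> x" "x < v" "v < y" "y \<le> b" "\<not> (x = a \<and> y = b)"
        unfolding F_def by blast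
      have "\<not> x < c" using cd(1) xy v by (auto simp: F_def)
      moreover have "\<not> c < x"
      proof
        assume "c < x"
        then have "v \<noteq> Suc c" using xy(3) by simp
        then have "{c, v} \<in> Q" using w by auto
        moreover have "v < 2 * n + 2" "y < 2 * n + 2" using xy(4,5) bV by simp_all
        ultimately show False using edge_interleave[of c v x y] xy(1,3,4) \<open>c < x\<close> by blast
      qed
      ultimately have "x = c" by simp
      moreover have "\<not> d < y"
      proof
        assume "d < y"
        moreover have "x < d" using xy(3) v(2) by simp
        ultimately show False using cd(2) xy(1,2,5,6) by (auto simp: F_def)
      qed
      ultimately show ?thesis using xy v by auto
    qed
    have finY: "finite ?Y" by (rule finite_subset[of _ "{..d}"]) auto
    have "?Y \<noteq> {}" using cover[of "Suc c"] cd(3) False by auto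
    then have mx: "Max ?Y \<in> ?Y" using finY Max_in by blast
    have "\<not> Max ?Y < d"
    proof
      assume "Max ?Y < d"
      then obtain y where "y \<in> ?Y" "Max ?Y < y" using cover[of "Max ?Y"] mx by blast
      then show False using Max_ge[OF finY] by (meson linorder_not_less)
    qed
    then have "Max ?Y = d" using mx by auto
    then show ?thesis using mx by auto
  qed
  have mid: "\<exists>m\<in>F. a < m \<and> m < b"
  proof (rule ccontr)
    assume "\<not> ?thesis"
    then have "F \<inter> {a<..<b} = {}" by auto
    then show False using consecutive[OF ab_in ab] by simp
  qed
  then obtain m where m: "m \<in> F" "a < m" "m < b" by blast
  have "card {a, m, b} \<le> card F" using m ab_in finF by (intro card_mono) auto
  then have card3: "card F \<ge> 3" using m by simp
  have sidesF: "sides F \<subseteq> boundary_edges n \<union> Q"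
  proof
    fix g assume "g \<in> sides F"
    then obtain c d where g: "g = {c, d}" "c < d" "c \<in> F" "d \<in> F" "F \<inter> {c<..<d} = {} \<or> F \<subseteq> {c..d}"
      by (rule sidesE)
    from g(5) show "g \<in> boundary_edges n \<union> Q"
    proof
      assume "F \<inter> {c<..<d} = {}"
      then show ?thesis using consecutive g by auto
    next
      assume "F \<subseteq> {c..d}"
      then have "c \<le> a" "b \<le> d" using ab_in by auto
      moreover have "a \<le> c" "d \<le> b" using g(3,4) sub by auto
      ultimately have "c = a" "d = b" by simp_all
      then show ?thesis using eB g by auto
    qed
  qed
  have chords: "g \<in> sides F" if g: "g \<in> Q" "g \<subseteq> F" for g
  proof -
    obtain c d where cd: "g = {c, d}" "c < d" using diagonalE[OF g(1)] by metis
    have "F \<inter> {c<..<d} = {} \<or> F \<subseteq> {c..d}"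
    proof (rule ccontr)
      assume neg: "\<not> ?thesis"
      then obtain v where v: "v \<in> F" "c < v" "v < d" by auto
      moreover have "\<not> (c = a \<and> d = b)" using neg sub by blast
      moreover have "a \<le> c" "d \<le> b" using g sub cd by auto
      ultimately show False using g cd by (auto simp: F_def)
    qed
    then show ?thesis using cd g sides_doubletonI[of c d F] by auto
  qed
  show "F \<in> squares n Q" unfolding cells_def polygon_vertices_def
    using sub bV card3 sidesF chords by auto
qed

text \<open>
  Among the edges that strictly enclose \<open>{a, b}\<close>, with the root edge \<open>{0, 2 n + 1}\<close> included, take
  one of least width. Both \<open>a\<close> and \<open>b\<close> are visible from it, since a diagonal hiding one of them
  without crossing \<open>{a, b}\<close> would enclose \<open>{a, b}\<close> more tightly. So the square below it has
  \<open>{a, b}\<close> as a side.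
\<close>

lemma cell_above_exists:
  assumes e: "{a, b} \<in> Q \<union> boundary_edges n" and ab: "a < b" and nroot: "{a, b} \<noteq> root"
  obtains F where "F \<in> squares n Q" "{a, b} \<in> sides F" "\<not> F \<subseteq> {a..b}"
proof -
  have bV: "b < 2 * n + 2"
    using edge_bound[OF e ab] .
  define encloses where
    "encloses = (\<lambda>c d. {c, d} \<in> insert root Q \<and> c \<le> a \<and> b \<le> d \<and> \<not> (c = a \<and> d = b))"
  define width where "width = (\<lambda>k. \<exists>c d. encloses c d \<and> k = d - c)"
  have "encloses 0 (2 * n + 1)" using bV nroot by (auto simp: encloses_def)
  then have "\<exists>k. width k" unfolding width_def by blast
  then obtain k where k: "width k" "\<forall>m<k. \<not> width m"
    using exists_least_iff[of width] by blast
  then obtain c d where "encloses c d" and kcd: "k = d - c" unfolding width_def by blast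
  then have cd: "{c, d} \<in> insert root Q" "c \<le> a" "b \<le> d" "\<not> (c = a \<and> d = b)"
    by (simp_all add: encloses_def)
  have "c < d" using cd ab by simp
  define F where "F = {v \<in> {c..d}. \<forall>x y. {x, y} \<in> Q \<longrightarrow> c \<le> x \<longrightarrow> x < v \<longrightarrow> v < y \<longrightarrow> y \<le> d \<longrightarrow> x = c \<and> y = d}"
  note F = cell_below_exists[OF cd(1) \<open>c < d\<close>, folded F_def]
  have uncovered: "v \<in> F" if v: "v = a \<or> v = b" for v
  proof (rule ccontr)
    assume "v \<notin> F"
    then obtain x y where xy: "{x, y} \<in> Q" "c \<le> x" "x < v" "v < y" "y \<le> d" "\<not> (x = c \<and> y = d)"
      using v cd ab by (auto simp: F_def)
    have yV: "y < 2 * n + 2" using cellD(2)[OF F(1,3)] xy by simp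
    have "\<not> (a < x \<and> x < b \<and> b < y)" "\<not> (x < a \<and> a < y \<and> y < b)"
      using edge_interleave[of a b x y] edge_interleave[of x y a b] e xy(1) yV bV by blast+
    then have "x \<le> a" "b \<le> y" "\<not> (x = a \<and> y = b)" using v xy(3,4) ab by linarith+
    then have "encloses x y" using xy(1) by (simp add: encloses_def)
    then have "width (y - x)" unfolding width_def by blast
    moreover have "y - x < k" using xy(2-6) kcd by linarith
    ultimately show False using k(2) by blast
  qed
  then have sub: "{a, b} \<subseteq> F" by simp
  have "\<not> F \<subseteq> {a..b}" using F(2,3) cd by auto
  moreover have "{a, b} \<in> sides F"
    using e
  proof
    assume "{a, b} \<in> Q" then show ?thesis using cellD(5)[OF F(1)] sub by blast
  next
    assume "{a, b} \<in> boundary_edges n"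
    then show ?thesis
    proof (cases rule: boundary_edge_cases)
      case (1 i)
      then have "a = i" "b = Suc i" using ab by (auto simp: doubleton_eq_iff)
      then show ?thesis using sub by (intro sides_doubletonI) auto
    next
      case 2
      then show ?thesis using nroot by simp
    qed
  qed
  ultimately show ?thesis using that F(1) by blast
qed

section \<open>Counting squares and inner edges\<close>

lemma finite_squares: "finite (squares n Q)"
proof (rule finite_subset)
  show "squares n Q \<subseteq> Pow {..<2 * n + 2}" by (auto simp: cells_def polygon_vertices_def)
qed simp

lemma finite_Q: "finite Q"
proof (rule finite_subset)
  show "Q \<subseteq> Pow {..<2 * n + 2}" using Q_diagonals by (auto simp: diagonals_def polygon_vertices_def)
qed simp

text \<open>
  With the boundary edge \<open>root\<close> as the root of the tree of squares, this is the side of a square that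
  faces the root.
\<close>

definition top_side :: "square \<Rightarrow> edge" where
  "top_side F = {Min F, Max F}"

lemma cell_extremes:
  assumes "F \<in> squares n Q"
  shows "Min F < Max F" "Min F \<in> F" "Max F \<in> F" "F \<subseteq> {Min F..Max F}" "top_side F \<in> sides F"
    "below (top_side F) F"
proof -
  have fin: "finite F" and ne: "F \<noteq> {}" using cellD(1,3)[OF assms] by auto
  show mem: "Min F \<in> F" "Max F \<in> F" using fin ne by simp_all
  show sub: "F \<subseteq> {Min F..Max F}" using fin by auto
  have "Min F \<noteq> Max F"
  proof
    assume "Min F = Max F"
    then have "F \<subseteq> {Min F, Max F}" using sub by simp
    then show False using cell_not_subset_doubleton[OF assms] by blast
  qed
  then show lt: "Min F < Max F" using mem sub fin by (simp add: le_neq_implies_less)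
  show "top_side F \<in> sides F" unfolding top_side_def
    using sides_doubletonI[OF lt mem] sub by blast
  show "below (top_side F) F" unfolding top_side_def using below_doubleton[OF lt] sub by blast
qed

lemma below_side_top:
  assumes F: "F \<in> squares n Q" and e: "e \<in> sides F"
  shows "below e F \<longleftrightarrow> e = top_side F"
proof
  obtain a b where ab: "e = {a, b}" "a < b" "a \<in> F" "b \<in> F" using e by (rule sidesE)
  assume "below e F"
  then have "F \<subseteq> {a..b}" using ab below_doubleton by simp
  then have "a = Min F" "b = Max F"
    using ab(3,4) cellD(1)[OF F] by (auto intro!: Min_eqI[symmetric] Max_eqI[symmetric])
  then show "e = top_side F" using ab by (simp add: top_side_def)
qed (use cell_extremes[OF F] in simp)

lemma edgeE:
  assumes "e \<in> Q \<union> boundary_edges n"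
  obtains a b where "e = {a, b}" "a < b"
  using assms
proof
  assume "e \<in> Q"
  then show ?thesis by (rule diagonalE) (rule that)
next
  assume "e \<in> boundary_edges n"
  then show ?thesis
  proof (cases rule: boundary_edge_cases)
    case (1 i)
    then show ?thesis using that[of i "Suc i"] by blast
  next
    case 2
    then show ?thesis by (rule that) simp
  qed
qed

lemma cell_below_edge:
  assumes "e \<in> insert root Q" "e = {a, b}" "a < b"
  obtains F where "F \<in> squares n Q" "a \<in> F" "b \<in> F" "F \<subseteq> {a..b}"
  by (rule that[OF cell_below_exists[OF assms(1)[unfolded assms(2)] assms(3)]])

text \<open>
  Below each inner edge, and below the root edge, there is exactly one square having it as a side.
\<close>

lemma top_side_bij: "bij_betw top_side (squares n Q) (insert root Q)"
proof (rule bij_betwI')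
  fix F G assume FG: "F \<in> squares n Q" "G \<in> squares n Q"
  show "(top_side F = top_side G) = (F = G)"
  proof
    assume eq: "top_side F = top_side G"
    then have "card (top_side F) = 2" "top_side F \<subseteq> F" "top_side F \<subseteq> G"
      "below (top_side F) F" "below (top_side F) G"
      using cell_extremes[OF FG(1)] cell_extremes[OF FG(2)] card_side side_subset by metis+
    then show "F = G" using cell_unique[OF FG] by blast
  qed simp
next
  fix F assume F: "F \<in> squares n Q"
  show "top_side F \<in> insert root Q"
  proof (cases "top_side F \<in> Q")
    case False
    then have "{Min F, Max F} \<in> boundary_edges n"
      using cellD(4)[OF F cell_extremes(5)[OF F]] by (auto simp: top_side_def)
    moreover have "Max F \<noteq> Suc (Min F)"
    proof
      assume "Max F = Suc (Min F)"
      then have "F \<subseteq> {Min F, Max F}" using cell_extremes(4)[OF F]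
        by (simp add: atLeastAtMostSuc_conv insert_commute)
      then show False using cell_not_subset_doubleton[OF F] by blast
    qed
    ultimately have "Min F = 0" "Max F = 2 * n + 1"
      using boundary_edge_ordered[OF _ cell_extremes(1)[OF F]] by auto
    then show ?thesis by (simp add: top_side_def)
  qed simp
next
  fix e assume e: "e \<in> insert root Q"
  have "e \<in> Q \<union> boundary_edges n" using e root_edge_boundary[of n] by blast
  then obtain a b where ab: "e = {a, b}" "a < b" by (rule edgeE)
  obtain F where F: "F \<in> squares n Q" "a \<in> F" "b \<in> F" "F \<subseteq> {a..b}"
    by (rule cell_below_edge[OF e ab])
  then have "Min F = a" "Max F = b"
    using cellD(1)[OF F(1)] by (auto intro!: Min_eqI Max_eqI)
  then show "\<exists>F\<in>squares n Q. e = top_side F" using F(1) ab unfolding top_side_def by blast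
qed

lemma root_not_diagonal: "root \<notin> Q"
  using root_edge_boundary diagonal_not_boundary by blast

text \<open>
  Together with the disjointness below: each edge except the root edge has exactly one square
  above it, to which it belongs as a side that is not the top side.
\<close>

lemma other_sides_union:
  "(\<Union>F\<in>squares n Q. sides F - {top_side F}) = (Q \<union> boundary_edges n) - {root}"
proof
  show "(\<Union>F\<in>squares n Q. sides F - {top_side F}) \<subseteq> Q \<union> boundary_edges n - {root}"
  proof
    fix e assume "e \<in> (\<Union>F\<in>squares n Q. sides F - {top_side F})"
    then obtain F where F: "F \<in> squares n Q" "e \<in> sides F" "e \<noteq> top_side F" by blast
    have "F \<subseteq> {0..2 * n + 1}" using cellD(2)[OF F(1)] by fastforce
    then have "e \<noteq> root" using below_side_top[OF F(1,2)] F(3) below_doubleton[of 0 "2 * n + 1" F] by auto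
    then show "e \<in> Q \<union> boundary_edges n - {root}" using cellD(4)[OF F(1,2)] by blast
  qed
  show "Q \<union> boundary_edges n - {root} \<subseteq> (\<Union>F\<in>squares n Q. sides F - {top_side F})"
  proof
    fix e assume e: "e \<in> Q \<union> boundary_edges n - {root}"
    then have "e \<in> Q \<union> boundary_edges n" by blast
    then obtain a b where ab: "e = {a, b}" "a < b" by (rule edgeE)
    then obtain F where F: "F \<in> squares n Q" "e \<in> sides F" "\<not> F \<subseteq> {a..b}"
      using cell_above_exists[of a b] e by auto
    then have "e \<noteq> top_side F" using below_side_top ab below_doubleton by metis
    then show "e \<in> (\<Union>F\<in>squares n Q. sides F - {top_side F})" using F by blast
  qed
qed

lemma other_sides_disjoint:
  assumes "F \<in> squares n Q" "G \<in> squares n Q" "F \<noteq> G"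
  shows "(sides F - {top_side F}) \<inter> (sides G - {top_side G}) = {}"
proof (rule ccontr)
  assume "\<not> ?thesis"
  then obtain e where e: "e \<in> sides F" "e \<noteq> top_side F" "e \<in> sides G" "e \<noteq> top_side G" by blast
  then have "below e F = below e G" using below_side_top assms by metis
  then show False using cell_unique[OF assms(1,2), of e] e assms(3) card_side side_subset by blast
qed

text \<open>
  Let \<open>N\<close> be the number of squares. Top sides give \<open>N = card Q + 1\<close>. The three other sides of each
  square run exactly once through all edges but the root edge, which gives
  \<open>3 N = card Q + (2 n + 2) - 1\<close>. These equations determine \<open>N\<close> and \<open>card Q\<close>.
\<close>

lemma card_squares_card_Q: "card (squares n Q) = n" "card Q = n - 1"
proof -
  have N: "card (squares n Q) = card Q + 1"
    using bij_betw_same_card[OF top_side_bij] finite_Q root_not_diagonal by simp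
  have "card (\<Union>F\<in>squares n Q. sides F - {top_side F}) = (\<Sum>F\<in>squares n Q. card (sides F - {top_side F}))"
    using finite_squares other_sides_disjoint cellD(3) card_sides_four(2)
    by (intro card_UN_disjoint) auto
  also have "\<dots> = (\<Sum>F\<in>squares n Q. 3)"
    using cell_extremes(5) card_sides_four cellD(3) by (intro sum.cong) (auto simp: card_Diff_singleton)
  finally have "card ((Q \<union> boundary_edges n) - {root}) = 3 * card (squares n Q)"
    unfolding other_sides_union by simp
  moreover have "card (Q \<union> boundary_edges n) = card Q + (2 * n + 2)"
    using card_boundary_edges[OF n_pos] finite_Q diagonal_not_boundary by (subst card_Un_disjoint) auto
  then have "card ((Q \<union> boundary_edges n) - {root}) = card Q + (2 * n + 1)"
    using root_edge_boundary[of n] by (subst card_Diff_singleton) auto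
  ultimately show "card (squares n Q) = n" "card Q = n - 1" using N by simp_all
qed

section \<open>Adjacent squares\<close>

lemma adjacent_via_sym: "adjacent_via n Q e s t \<longleftrightarrow> adjacent_via n Q e t s"
  by (auto simp: adjacent_via_def)

lemma adjacent_via_below:
  assumes "adjacent_via n Q e s t"
  shows "below e s \<noteq> below e t"
  using assms cell_unique[of s t e] card_side side_subset unfolding adjacent_via_def by metis

text \<open>
  Crossing \<open>e\<close> does not cross any other inner edge: if \<open>f\<close> separated \<open>s\<close> from \<open>t\<close>, their common
  vertices, among them both ends of \<open>e\<close>, would be ends of \<open>f\<close>.
\<close>

lemma adjacent_via_below_other:
  assumes "adjacent_via n Q e s t" "f \<in> Q" "f \<noteq> e"
  shows "below f s = below f t"
proof (rule ccontr)
  assume neq: "below f s \<noteq> below f t"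
  have *: "s \<in> squares n Q" "t \<in> squares n Q" "e \<in> sides s" "e \<in> sides t" "e \<in> Q"
    using assms unfolding adjacent_via_def by auto
  have "e \<subseteq> f" using below_differ_inter[OF *(1,2) assms(2) neq] *(3,4) side_subset by blast
  moreover have "card f = 2" "card e = 2" using assms(2) *(5) by (auto elim!: diagonalE)
  ultimately show False using assms(3) card_subset_eq[of f e]
    by (metis card.infinite zero_neq_numeral)
qed

lemma neighbour_exists:
  assumes "s \<in> squares n Q" "e \<in> Q" "e \<in> sides s"
  obtains t where "adjacent_via n Q e s t"
proof -
  obtain a b where ab: "e = {a, b}" "a < b" using diagonalE[OF assms(2)] by metis
  obtain F where F: "F \<in> squares n Q" "a \<in> F" "b \<in> F" "F \<subseteq> {a..b}"
    by (rule cell_below_edge[OF _ ab]) (use assms in blast)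
  have eF: "e \<in> sides F" using ab F by (auto intro: sides_doubletonI)
  have "{a, b} \<noteq> root" using root_not_diagonal assms ab by metis
  then obtain G where G: "G \<in> squares n Q" "e \<in> sides G" "\<not> G \<subseteq> {a..b}"
    using cell_above_exists[of a b] ab assms by auto
  have "F \<noteq> G" using F(4) G(3) by blast
  then have "adjacent_via n Q e s F \<or> adjacent_via n Q e s G"
    using F(1) G eF assms by (auto simp: adjacent_via_def)
  then show ?thesis using that by blast
qed

lemma edge_squares:
  assumes "e \<in> Q"
  obtains s t where "adjacent_via n Q e s t"
proof -
  obtain a b where ab: "e = {a, b}" "a < b" using diagonalE[OF assms] by metis
  obtain F where F: "F \<in> squares n Q" "a \<in> F" "b \<in> F" "F \<subseteq> {a..b}"
    by (rule cell_below_edge[OF _ ab]) (use assms in blast)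
  have "e \<in> sides F" unfolding ab(1) using sides_doubletonI[OF ab(2)] F by blast
  then obtain t where "adjacent_via n Q e F t" using neighbour_exists[OF F(1) assms] by metis
  then show ?thesis by (rule that)
qed

lemma incident_squares:
  assumes "adjacent_via n Q e s t" "u \<in> squares n Q" "e \<in> sides u"
  shows "u = s \<or> u = t"
proof (rule ccontr)
  assume "\<not> ?thesis"
  then have "adjacent_via n Q e u s" "adjacent_via n Q e u t"
    using assms by (auto simp: adjacent_via_def)
  then show False using adjacent_via_below assms(1) by blast
qed

lemma shared_edge_eq:
  assumes "adjacent_via n Q e s t"
  shows "shared_edge n Q s t = e"
  unfolding shared_edge_def
proof (rule the_equality)
  show "adjacent_via n Q e s t" by fact
next
  fix f assume f: "adjacent_via n Q f s t"
  then have "f \<in> Q" by (simp add: adjacent_via_def)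
  with f show "f = e" using adjacent_via_below_other[OF assms] adjacent_via_below[OF f] by blast
qed

lemma adjacent_shared_edge:
  "adjacent n Q s t \<Longrightarrow> adjacent_via n Q (shared_edge n Q s t) s t"
  unfolding adjacent_def using shared_edge_eq by metis

text \<open>
  Of the four combinations of a part of \<open>e\<close> with a part of \<open>f\<close>, at least one contains no square: if
  the two intervals of vertices are nested, the inner one has nothing outside the outer one, and
  otherwise they have at most one vertex in common.
\<close>

lemma cuts_nested:
  assumes "e \<in> Q" "f \<in> Q" "e \<noteq> f"
    and sq: "s \<in> squares n Q" "t \<in> squares n Q" "u \<in> squares n Q" "v \<in> squares n Q"
    and "below e s = below e t" "below e u = below e v" "below e s \<noteq> below e u"
    and "below f s \<noteq> below f t" "below f u \<noteq> below f v"
  shows False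
proof -
  \<comment> \<open>The pairs \<open>s\<close>, \<open>t\<close> and \<open>u\<close>, \<open>v\<close> lie on different parts of \<open>e\<close> and are both split by \<open>f\<close>.\<close>
  have quadrants: "\<exists>w\<in>squares n Q. below e w = p \<and> below f w = q" for p q
    using assms by (cases "p = below e s"; cases "q = below f s"; cases "q = below f u") auto
  obtain a b where e: "e = {a, b}" "a < b" using diagonalE[OF assms(1)] by metis
  obtain c d where f: "f = {c, d}" "c < d" using diagonalE[OF assms(2)] by metis
  have V: "b < 2 * n + 2" "d < 2 * n + 2" using edge_bound assms(1,2) e f by blast+
  have nocross: "\<not> (a < c \<and> c < b \<and> b < d)" "\<not> (c < a \<and> a < d \<and> d < b)"
    using edge_interleave[of a b c d] edge_interleave[of c d a b] assms(1,2) e(1) f(1) V by auto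
  obtain w where w: "w \<in> squares n Q" "w \<subseteq> {a..b}" "w \<subseteq> {c..d}"
    using quadrants[of True True] e f by (auto simp: below_doubleton)
  obtain x where x: "\<not> x \<subseteq> {a..b}" "x \<subseteq> {c..d}"
    using quadrants[of False True] e f by (auto simp: below_doubleton)
  obtain y where y: "y \<subseteq> {a..b}" "\<not> y \<subseteq> {c..d}"
    using quadrants[of True False] e f by (auto simp: below_doubleton)
  have "\<not> (a \<le> c \<and> d \<le> b)" using x by fastforce
  moreover have "\<not> (c \<le> a \<and> b \<le> d)" using y by fastforce
  ultimately have "b \<le> c \<or> d \<le> a" using nocross by linarith
  then have "w \<subseteq> {b, b} \<or> w \<subseteq> {a, a}" using w(2,3) by fastforce
  then show False using cell_not_subset_doubleton[OF w(1)] by blast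
qed

section \<open>Routes and the inner edges they cross\<close>

text \<open>
  For a pair \<open>p\<close> of squares these are the inner edges crossed by the path between them. The
  separating edges determine everything that matters about a serpent (its end edges, its turns and
  whether it is a serpent at all), which allows it to be studied without paths.
\<close>

definition cuts :: "square set \<Rightarrow> edge set" where
  "cuts p = {e \<in> Q. \<exists>s\<in>p. \<exists>t\<in>p. below e s \<noteq> below e t}"

lemma cuts_pair: "cuts {s, t} = {e \<in> Q. below e s \<noteq> below e t}"
  unfolding cuts_def by blast

definition crossed_edges :: "square list \<Rightarrow> edge set" where
  "crossed_edges xs = (\<lambda>i. shared_edge n Q (xs ! i) (xs ! Suc i)) ` {i. Suc i < length xs}"

lemma crossed_edges_Cons2:
  "crossed_edges (x # y # zs) = insert (shared_edge n Q x y) (crossed_edges (y # zs))"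
proof -
  have "{i. Suc i < length (x # y # zs)} = insert 0 (Suc ` {i. Suc i < length (y # zs)})"
  proof (rule set_eqI)
    fix i
    show "i \<in> {i. Suc i < length (x # y # zs)} \<longleftrightarrow> i \<in> insert 0 (Suc ` {i. Suc i < length (y # zs)})"
      by (cases i) auto
  qed
  then show ?thesis unfolding crossed_edges_def by (simp add: image_image)
qed

lemma square_path_Cons2:
  "square_path n Q (x # y # zs) \<longleftrightarrow>
    x \<in> squares n Q \<and> x \<notin> set (y # zs) \<and> adjacent n Q x y \<and> square_path n Q (y # zs)"
proof -
  have "(\<forall>i. i + 1 < length (x # y # zs) \<longrightarrow> adjacent n Q ((x # y # zs) ! i) ((x # y # zs) ! (i + 1))) \<longleftrightarrow>
    adjacent n Q x y \<and> (\<forall>i. i + 1 < length (y # zs) \<longrightarrow> adjacent n Q ((y # zs) ! i) ((y # zs) ! (i + 1)))"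
    (is "(\<forall>i. ?P i) \<longleftrightarrow> _ \<and> (\<forall>i. ?R i)")
  proof -
    have "(\<forall>i. ?P i) \<longleftrightarrow> ?P 0 \<and> (\<forall>i. ?P (Suc i))" using not0_implies_Suc by metis
    then show ?thesis by simp
  qed
  then show ?thesis unfolding square_path_def by auto
qed

lemma square_path_step:
  assumes "square_path n Q xs" "Suc i < length xs"
  shows "adjacent_via n Q (shared_edge n Q (xs ! i) (xs ! Suc i)) (xs ! i) (xs ! Suc i)"
  using assms adjacent_shared_edge by (simp add: square_path_def)

lemma square_path_incident:
  assumes "square_path n Q xs" "Suc i < length xs" "u \<in> squares n Q"
    and "shared_edge n Q (xs ! i) (xs ! Suc i) \<in> sides u"
  shows "u = xs ! i \<or> u = xs ! Suc i"
  using incident_squares[OF square_path_step[OF assms(1,2)] assms(3,4)] .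

text \<open>
  Each step of a path changes the part of exactly one edge. No edge is crossed twice, because it is
  incident to two squares only and a path visits each of them at most once.
\<close>

lemma square_path_cuts:
  "square_path n Q xs \<Longrightarrow> cuts {hd xs, last xs} = crossed_edges xs"
proof (induction xs rule: induct_list012)
  case 1
  then show ?case by (simp add: square_path_def)
next
  case (2 x)
  then show ?case by (simp add: cuts_def crossed_edges_def)
next
  case (3 x y zs)
  define e where "e = shared_edge n Q x y"
  define t where "t = last (y # zs)"
  have path: "square_path n Q (y # zs)" "x \<in> squares n Q" "x \<notin> set (y # zs)" "adjacent n Q x y"
    using 3(3) by (auto simp: square_path_Cons2)
  have adj: "adjacent_via n Q e x y" unfolding e_def using path(4) by (rule adjacent_shared_edge)
  have eQ: "e \<in> Q" "e \<in> sides x" using adj by (auto simp: adjacent_via_def)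
  have IH: "cuts {y, t} = crossed_edges (y # zs)" using 3(2)[OF path(1)] by (simp add: t_def)
  have "e \<notin> crossed_edges (y # zs)"
  proof
    assume "e \<in> crossed_edges (y # zs)"
    then obtain i where i: "Suc i < length (y # zs)"
      "e = shared_edge n Q ((y # zs) ! i) ((y # zs) ! Suc i)"
      by (auto simp: crossed_edges_def)
    have "x = (y # zs) ! i \<or> x = (y # zs) ! Suc i"
      using square_path_incident[OF path(1) i(1) path(2)] i(2) eQ by blast
    moreover have "(y # zs) ! i \<in> set (y # zs)" "(y # zs) ! Suc i \<in> set (y # zs)"
      using i(1) by (intro nth_mem; simp)+
    ultimately show False using path(3) by metis
  qed
  then have e_not: "e \<notin> cuts {y, t}" using IH by simp
  have "f \<in> cuts {x, t} \<longleftrightarrow> f = e \<or> f \<in> cuts {y, t}" for f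
  proof (cases "f = e")
    case True
    then show ?thesis using e_not adjacent_via_below[OF adj] eQ by (auto simp: cuts_pair)
  next
    case False
    then show ?thesis using adjacent_via_below_other[OF adj, of f] by (auto simp: cuts_pair)
  qed
  then have "cuts {x, t} = insert e (cuts {y, t})" by blast
  then show ?case using IH by (simp add: crossed_edges_Cons2 e_def t_def)
qed

text \<open>
  From \<open>s\<close>, step across a side separating \<open>s\<close> from \<open>t\<close>. This removes one edge from the set of
  separating edges and adds none; the monotonicity of these sets along the path also shows that
  no square is visited twice.
\<close>

lemma square_path_exists:
  assumes "s \<in> squares n Q" "t \<in> squares n Q"
  shows "\<exists>xs. square_path n Q xs \<and> hd xs = s \<and> last xs = t \<and> (\<forall>u\<in>set xs. cuts {u, t} \<subseteq> cuts {s, t})"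
  using assms(1)
proof (induction "card (cuts {s, t})" arbitrary: s rule: less_induct)
  case less
  show ?case
  proof (cases "s = t")
    case True
    then show ?thesis using less.prems by (intro exI[of _ "[s]"]) (simp add: square_path_def)
  next
    case False
    then obtain e where e: "e \<in> Q" "e \<in> sides s" "below e s \<noteq> below e t"
      using separating_side[OF less.prems assms(2)] by metis
    obtain u where u: "adjacent_via n Q e s u" using neighbour_exists[OF less.prems e(1,2)] by metis
    have below_u: "below e u = below e t" using adjacent_via_below[OF u] e(3) by blast
    have uc: "cuts {u, t} = cuts {s, t} - {e}"
    proof -
      have "f \<in> cuts {u, t} \<longleftrightarrow> f \<in> cuts {s, t} \<and> f \<noteq> e" for f
        using adjacent_via_below_other[OF u, of f] below_u by (cases "f = e") (auto simp: cuts_pair)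
      then show ?thesis by blast
    qed
    have e_in: "e \<in> cuts {s, t}" using e by (simp add: cuts_pair)
    have "finite (cuts {s, t})" using finite_Q by (simp add: cuts_pair)
    then have "card (cuts {u, t}) < card (cuts {s, t})"
      unfolding uc using e_in by (rule card_Diff1_less)
    moreover have "u \<in> squares n Q" using u by (simp add: adjacent_via_def)
    ultimately obtain xs where xs: "square_path n Q xs" "hd xs = u" "last xs = t"
      "\<forall>v\<in>set xs. cuts {v, t} \<subseteq> cuts {u, t}"
      using less.hyps by blast
    obtain ys where ys: "xs = u # ys" using xs(1,2) by (cases xs) (auto simp: square_path_def)
    have "s \<notin> set xs" using xs(4) e_in uc by blast
    moreover have "adjacent n Q s u" using u unfolding adjacent_def by blast
    ultimately have "square_path n Q (s # xs)"
      using xs(1) less.prems unfolding ys by (simp add: square_path_Cons2)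
    moreover have "\<forall>v\<in>set (s # xs). cuts {v, t} \<subseteq> cuts {s, t}" using xs(4) uc by auto
    ultimately show ?thesis using xs(3) ys by (intro exI[of _ "s # xs"]) simp
  qed
qed

text \<open>
  The first edge \<open>e\<close> of the one path separates the two ends, so the other path crosses \<open>e\<close> as well. It
  does so in its first step, since it visits the starting square only there.
\<close>

lemma square_path_unique:
  "square_path n Q xs \<Longrightarrow> square_path n Q ys \<Longrightarrow> hd xs = hd ys \<Longrightarrow> last xs = last ys \<Longrightarrow> xs = ys"
proof (induction xs arbitrary: ys rule: induct_list012)
  case 1
  then show ?case by (simp add: square_path_def)
next
  case (2 x)
  obtain zs where ys: "ys = x # zs" using 2 by (cases ys) (auto simp: square_path_def)
  have "zs = []"
  proof (rule ccontr)
    assume "zs \<noteq> []"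
    then have "last ys \<in> set zs" using ys by simp
    then show False using 2 ys by (simp add: square_path_def)
  qed
  then show ?case using ys by simp
next
  case (3 x y zs)
  define t where "t = last (y # zs)"
  have path: "square_path n Q (y # zs)" "x \<in> squares n Q" "x \<notin> set (y # zs)" "adjacent n Q x y"
    using 3(3) by (auto simp: square_path_Cons2)
  have "t \<in> set (y # zs)" unfolding t_def by (rule last_in_set) simp
  then have "x \<noteq> t" using path(3) by blast
  have "ys \<noteq> []" "hd ys = x" "last ys = t" using 3 by (auto simp: square_path_def t_def)
  then obtain y' zs' where ys: "ys = x # y' # zs'"
    using \<open>x \<noteq> t\<close> by (cases ys; cases "tl ys") auto
  define e where "e = shared_edge n Q x y"
  have adj: "adjacent_via n Q e x y" unfolding e_def using path(4) by (rule adjacent_shared_edge)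
  have "e \<in> cuts {hd ys, last ys}"
    using square_path_cuts[OF 3(3)] 3(5,6) by (simp add: crossed_edges_Cons2 e_def)
  then have "e \<in> crossed_edges ys" using square_path_cuts[OF 3(4)] by simp
  then obtain i where i: "Suc i < length ys" "e = shared_edge n Q (ys ! i) (ys ! Suc i)"
    by (auto simp: crossed_edges_def)
  have "ys ! 0 = ys ! i \<or> ys ! 0 = ys ! Suc i"
    using square_path_incident[OF 3(4) i(1) path(2)] i(2) adj ys by (simp add: adjacent_via_def)
  then have "i = 0" using 3(4) i(1) nth_eq_iff_index_eq[of ys 0] by (auto simp: square_path_def)
  then have adj': "adjacent_via n Q e x y'" using square_path_step[OF 3(4) i(1)] i(2) ys by simp
  have "y' = y"
    using incident_squares[OF adj, of y'] adj' by (auto simp: adjacent_via_def)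
  moreover have "square_path n Q (y' # zs')" using 3(4) ys by (simp add: square_path_Cons2)
  ultimately have "y # zs = y' # zs'" using 3(2)[OF path(1), of "y' # zs'"] 3(6) ys by simp
  then show ?case using ys by simp
qed

lemma route_path:
  assumes "s \<in> squares n Q" "t \<in> squares n Q"
  shows "square_path n Q (route n Q s t)" "hd (route n Q s t) = s" "last (route n Q s t) = t"
proof -
  have "\<exists>!xs. square_path n Q xs \<and> hd xs = s \<and> last xs = t"
    using square_path_exists[OF assms] square_path_unique by metis
  from theI'[OF this] show "square_path n Q (route n Q s t)" "hd (route n Q s t) = s"
    "last (route n Q s t) = t" unfolding route_def by auto
qed

lemma route_cuts:
  assumes "s \<in> squares n Q" "t \<in> squares n Q"
  shows "cuts {s, t} = crossed_edges (route n Q s t)"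
  using square_path_cuts[OF route_path(1)[OF assms]] route_path(2,3)[OF assms] by simp

lemma route_nth_0:
  assumes "s \<in> squares n Q" "t \<in> squares n Q"
  shows "route n Q s t ! 0 = s"
  using route_path(1,2)[OF assms] by (simp add: square_path_def hd_conv_nth)

lemma route_length:
  assumes "s \<in> squares n Q" "t \<in> squares n Q" "s \<noteq> t"
  shows "Suc 0 < length (route n Q s t)"
proof (rule ccontr)
  assume "\<not> ?thesis"
  moreover have "route n Q s t \<noteq> []" using route_path(1)[OF assms(1,2)] by (simp add: square_path_def)
  ultimately obtain x where "route n Q s t = [x]" by (cases "route n Q s t") auto
  then show False using route_path(2,3)[OF assms(1,2)] assms(3) by simp
qed

text \<open>
  Only the first step of the route can cross a side of \<open>s\<close>, as the route does not return to \<open>s\<close>.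
\<close>

lemma extremity_iff:
  assumes p: "p \<subseteq> squares n Q" "card p = 2"
  shows "extremity n Q p s e \<longleftrightarrow> s \<in> p \<and> e \<in> cuts p \<and> e \<in> sides s"
proof
  assume "extremity n Q p s e"
  then obtain t where t: "p = {s, t}" "s \<noteq> t" "e = shared_edge n Q s (route n Q s t ! 1)"
    by (auto simp: extremity_def)
  have st: "s \<in> squares n Q" "t \<in> squares n Q" using p t by auto
  note len = route_length[OF st t(2)]
  have e: "e = shared_edge n Q (route n Q s t ! 0) (route n Q s t ! Suc 0)"
    using t(3) route_nth_0[OF st] by simp
  then have "e \<in> crossed_edges (route n Q s t)" using len by (auto simp: crossed_edges_def)
  moreover have "e \<in> sides s"
    using square_path_step[OF route_path(1)[OF st] len] e route_nth_0[OF st]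
    by (simp add: adjacent_via_def)
  ultimately show "s \<in> p \<and> e \<in> cuts p \<and> e \<in> sides s" using route_cuts[OF st] t(1) by simp
next
  assume e: "s \<in> p \<and> e \<in> cuts p \<and> e \<in> sides s"
  obtain t where t: "p = {s, t}" "s \<noteq> t" using p(2) e by (auto simp: card_2_iff)
  have st: "s \<in> squares n Q" "t \<in> squares n Q" using p t by auto
  obtain i where i: "Suc i < length (route n Q s t)"
    "e = shared_edge n Q (route n Q s t ! i) (route n Q s t ! Suc i)"
    using e t(1) route_cuts[OF st] by (auto simp: crossed_edges_def)
  have "route n Q s t ! 0 = route n Q s t ! i \<or> route n Q s t ! 0 = route n Q s t ! Suc i"
    using square_path_incident[OF route_path(1)[OF st] i(1) st(1)] i(2) e route_nth_0[OF st] by simp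
  then have "i = 0" using i(1) route_path(1)[OF st] nth_eq_iff_index_eq[of "route n Q s t" 0]
    by (auto simp: square_path_def)
  then show "extremity n Q p s e" unfolding extremity_def using t i route_nth_0[OF st] by auto
qed

lemma square_path_turn:
  assumes xs: "square_path n Q xs" and i: "i + 2 < length xs"
    and e: "e = shared_edge n Q (xs ! i) (xs ! (i + 1))"
    and f: "f = shared_edge n Q (xs ! (i + 1)) (xs ! (i + 2))"
  shows "xs ! (i + 1) \<in> squares n Q" "e \<noteq> f" "e \<in> crossed_edges xs" "f \<in> crossed_edges xs"
    "e \<in> sides (xs ! (i + 1))" "f \<in> sides (xs ! (i + 1))"
proof -
  have adj: "adjacent_via n Q e (xs ! i) (xs ! (i + 1))" "adjacent_via n Q f (xs ! (i + 1)) (xs ! (i + 2))"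
    using square_path_step[OF xs, of i] square_path_step[OF xs, of "i + 1"] i e f by simp_all
  then show "xs ! (i + 1) \<in> squares n Q" "e \<in> sides (xs ! (i + 1))" "f \<in> sides (xs ! (i + 1))"
    by (simp_all add: adjacent_via_def)
  show "e \<in> crossed_edges xs" "f \<in> crossed_edges xs"
    unfolding crossed_edges_def using i e f by auto
  have "distinct xs" using xs by (simp add: square_path_def)
  then have "xs ! (i + 2) \<noteq> xs ! i" "xs ! (i + 2) \<noteq> xs ! (i + 1)"
    using i by (simp_all add: nth_eq_iff_index_eq)
  then show "e \<noteq> f" using incident_squares[OF adj(1), of "xs ! (i + 2)"] adj(2)
    by (auto simp: adjacent_via_def)
qed

text \<open>
  An edge crossed by a path is incident only to the two squares of that step. Two different crossed
  sides of \<open>u\<close> are therefore crossed in two consecutive steps which have \<open>u\<close> in common.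
\<close>

lemma square_path_turn_exists:
  assumes xs: "square_path n Q xs" and u: "u \<in> squares n Q" and ne: "e \<noteq> f"
    and e: "e \<in> crossed_edges xs" "e \<in> sides u" and f: "f \<in> crossed_edges xs" "f \<in> sides u"
  shows "\<exists>i. i + 2 < length xs \<and> xs ! (i + 1) = u \<and>
    {e, f} = {shared_edge n Q (xs ! i) u, shared_edge n Q u (xs ! (i + 2))}"
proof -
  obtain i where i: "Suc i < length xs" "e = shared_edge n Q (xs ! i) (xs ! Suc i)"
    using e by (auto simp: crossed_edges_def)
  obtain j where j: "Suc j < length xs" "f = shared_edge n Q (xs ! j) (xs ! Suc j)"
    using f by (auto simp: crossed_edges_def)
  have "u = xs ! i \<or> u = xs ! Suc i" using square_path_incident[OF xs i(1) u] i(2) e by simp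
  moreover have "u = xs ! j \<or> u = xs ! Suc j" using square_path_incident[OF xs j(1) u] j(2) f by simp
  moreover have "i \<noteq> j" using ne i(2) j(2) by blast
  moreover have "distinct xs" using xs by (simp add: square_path_def)
  then have "xs ! i = xs ! j \<Longrightarrow> i = j" "xs ! i = xs ! Suc j \<Longrightarrow> i = Suc j"
    "xs ! Suc i = xs ! j \<Longrightarrow> Suc i = j" "xs ! Suc i = xs ! Suc j \<Longrightarrow> i = j"
    using i(1) j(1) by (simp_all add: nth_eq_iff_index_eq)
  ultimately have "u = xs ! Suc i \<and> j = Suc i \<or> u = xs ! Suc j \<and> i = Suc j" by metis
  then show ?thesis
  proof
    assume "u = xs ! Suc i \<and> j = Suc i"
    then show ?thesis using i j by (intro exI[of _ i]) simp
  next
    assume "u = xs ! Suc j \<and> i = Suc j"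
    then show ?thesis using i j by (intro exI[of _ j]) (simp add: insert_commute)
  qed
qed

lemma passes_iff:
  assumes p: "p \<subseteq> squares n Q" "card p = 2"
  shows "passes n Q p u e f \<longleftrightarrow>
    u \<in> squares n Q \<and> e \<noteq> f \<and> e \<in> cuts p \<and> f \<in> cuts p \<and> e \<in> sides u \<and> f \<in> sides u"
proof
  assume "passes n Q p u e f"
  then obtain s t i where st: "p = {s, t}" "s \<noteq> t" and i: "i + 2 < length (route n Q s t)"
    "route n Q s t ! (i + 1) = u"
    "{e, f} = {shared_edge n Q (route n Q s t ! i) u, shared_edge n Q u (route n Q s t ! (i + 2))}"
    unfolding passes_def Let_def by (elim exE conjE)
  have sq: "s \<in> squares n Q" "t \<in> squares n Q" using p st by auto
  note turn = square_path_turn[OF route_path(1)[OF sq] i(1) refl refl, unfolded i(2), folded route_cuts[OF sq]]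
  from i(3) show "u \<in> squares n Q \<and> e \<noteq> f \<and> e \<in> cuts p \<and> f \<in> cuts p \<and> e \<in> sides u \<and> f \<in> sides u"
    unfolding doubleton_eq_iff using turn st(1) by auto
next
  assume *: "u \<in> squares n Q \<and> e \<noteq> f \<and> e \<in> cuts p \<and> f \<in> cuts p \<and> e \<in> sides u \<and> f \<in> sides u"
  obtain s t where st: "p = {s, t}" "s \<noteq> t" using p(2) by (auto simp: card_2_iff)
  have sq: "s \<in> squares n Q" "t \<in> squares n Q" using p st by auto
  have "\<exists>i. i + 2 < length (route n Q s t) \<and> route n Q s t ! (i + 1) = u \<and>
    {e, f} = {shared_edge n Q (route n Q s t ! i) u, shared_edge n Q u (route n Q s t ! (i + 2))}"
    using square_path_turn_exists[OF route_path(1)[OF sq], of u e f] * st(1) route_cuts[OF sq] by simp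
  then show "passes n Q p u e f"
    unfolding passes_def Let_def using st by (intro exI[of _ s] exI[of _ t] conjI)
qed

lemma opposite_sides_distinct: "opposite_sides s e f \<Longrightarrow> e \<noteq> f"
  using card_side[of e s] by (auto simp: opposite_sides_def)

lemma opposite_sides_sym: "opposite_sides s e f \<longleftrightarrow> opposite_sides s f e"
  by (auto simp: opposite_sides_def)

text \<open>
  Any two crossed sides of one square are the entry and the exit of the route in that square, so the
  turning condition speaks about the set of crossed edges alone.
\<close>

lemma serpent_iff:
  "serpent n Q p \<longleftrightarrow> p \<subseteq> squares n Q \<and> card p = 2 \<and>
    (\<forall>u\<in>squares n Q. \<forall>e\<in>cuts p. \<forall>f\<in>cuts p. \<not> opposite_sides u e f)"
proof
  assume "serpent n Q p"
  then obtain s t where st: "p = {s, t}" "s \<noteq> t" and sq: "s \<in> squares n Q" "t \<in> squares n Q"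
    and turns: "\<And>i. i + 2 < length (route n Q s t) \<Longrightarrow>
      \<not> opposite_sides (route n Q s t ! (i + 1))
        (shared_edge n Q (route n Q s t ! i) (route n Q s t ! (i + 1)))
        (shared_edge n Q (route n Q s t ! (i + 1)) (route n Q s t ! (i + 2)))"
    unfolding serpent_def Let_def by blast
  have "\<not> opposite_sides u e f" if u: "u \<in> squares n Q" and ef: "e \<in> cuts p" "f \<in> cuts p" for u e f
  proof
    assume opp: "opposite_sides u e f"
    then have "e \<in> sides u" "f \<in> sides u" by (auto simp: opposite_sides_def)
    then have "\<exists>i. i + 2 < length (route n Q s t) \<and> route n Q s t ! (i + 1) = u \<and>
      {e, f} = {shared_edge n Q (route n Q s t ! i) u, shared_edge n Q u (route n Q s t ! (i + 2))}"
      using square_path_turn_exists[OF route_path(1)[OF sq] u opposite_sides_distinct[OF opp]]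
        ef st(1) route_cuts[OF sq] by simp
    then obtain i where i: "i + 2 < length (route n Q s t)" "route n Q s t ! (i + 1) = u"
      "{e, f} = {shared_edge n Q (route n Q s t ! i) u, shared_edge n Q u (route n Q s t ! (i + 2))}"
      by (elim exE conjE)
    from i(3) show False unfolding doubleton_eq_iff
      using turns[OF i(1)] opp opposite_sides_sym unfolding i(2) by auto
  qed
  then show "p \<subseteq> squares n Q \<and> card p = 2 \<and>
    (\<forall>u\<in>squares n Q. \<forall>e\<in>cuts p. \<forall>f\<in>cuts p. \<not> opposite_sides u e f)"
    using st sq by auto
next
  assume *: "p \<subseteq> squares n Q \<and> card p = 2 \<and>
    (\<forall>u\<in>squares n Q. \<forall>e\<in>cuts p. \<forall>f\<in>cuts p. \<not> opposite_sides u e f)"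
  then obtain s t where st: "p = {s, t}" "s \<noteq> t" by (auto simp: card_2_iff)
  have sq: "s \<in> squares n Q" "t \<in> squares n Q" using * st by auto
  have "\<not> opposite_sides (route n Q s t ! (i + 1))
        (shared_edge n Q (route n Q s t ! i) (route n Q s t ! (i + 1)))
        (shared_edge n Q (route n Q s t ! (i + 1)) (route n Q s t ! (i + 2)))"
    if "i + 2 < length (route n Q s t)" for i
    using square_path_turn(1,3,4)[OF route_path(1)[OF sq] that refl refl] * st(1) route_cuts[OF sq]
    by simp
  then show "serpent n Q p" unfolding serpent_def Let_def using st sq by blast
qed

section \<open>Exchanging serpents at an edge\<close>

lemma cuts_subset: "cuts p \<subseteq> Q"
  by (simp add: cuts_def)

text \<open>
  A path that starts at \<open>s\<close> by crossing \<open>e\<close> crosses its other edges beyond \<open>e\<close>. If such an edge \<open>g\<close>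
  were on the near side, its two incident squares would represent both parts of \<open>g\<close> before \<open>e\<close>,
  while \<open>s'\<close> and \<open>t\<close> represent them beyond \<open>e\<close>, against \<open>cuts_nested\<close>.
\<close>

lemma cut_beyond:
  assumes adj: "adjacent_via n Q e s s'" and t: "t \<in> squares n Q" and e: "e \<in> cuts {s, t}"
    and g: "g \<in> cuts {s, t}" "g \<noteq> e" and v: "v \<in> squares n Q" "g \<in> sides v"
  shows "below e v = below e s'"
proof (rule ccontr)
  assume neq: "below e v \<noteq> below e s'"
  have gQ: "g \<in> Q" and eQ: "e \<in> Q" using g(1) e by (simp_all add: cuts_pair)
  have sq: "s' \<in> squares n Q" using adj by (simp add: adjacent_via_def)
  obtain w where w: "adjacent_via n Q g v w" using neighbour_exists[OF v(1) gQ v(2)] by metis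
  have "w \<in> squares n Q" using w by (simp add: adjacent_via_def)
  moreover have "below e v = below e w" using adjacent_via_below_other[OF w eQ] g(2) by simp
  moreover have "below e s' = below e t" using e adjacent_via_below[OF adj] by (auto simp: cuts_pair)
  moreover have "below g v \<noteq> below g w" using adjacent_via_below[OF w] .
  moreover have "below g s' \<noteq> below g t"
    using g(1) adjacent_via_below_other[OF adj gQ g(2)] by (simp add: cuts_pair)
  ultimately show False using cuts_nested[OF eQ gQ g(2)[symmetric] v(1) _ sq t] neq by blast
qed

lemma serpent_end_edge_unique:
  assumes "s \<in> squares n Q" "t \<in> squares n Q" "e \<in> cuts {s, t}" "e \<in> sides s" "f \<in> cuts {s, t}" "f \<in> sides s"
  shows "e = f"
proof (rule ccontr)
  assume neq: "e \<noteq> f"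
  have eQ: "e \<in> Q" using assms(3) by (simp add: cuts_pair)
  obtain s' where s': "adjacent_via n Q e s s'" using neighbour_exists[OF assms(1) eQ assms(4)] by metis
  have "below e s = below e s'"
    using cut_beyond[OF s' assms(2,3,5) _ assms(1,6)] neq by blast
  then show False using adjacent_via_below[OF s'] by simp
qed

text \<open>
  If \<open>p = {s, t}\<close> and \<open>q = {s', u}\<close> run through the common edge \<open>e\<close> of \<open>s\<close> and \<open>s'\<close> in opposite
  directions, then following \<open>q\<close> backwards from \<open>u\<close> to \<open>s\<close> and \<open>p\<close> from \<open>s'\<close> on to \<open>t\<close> gives a
  serpent from \<open>u\<close> to \<open>t\<close>. It makes the turns of \<open>p\<close> and \<open>q\<close>; the pattern only loses the
  extremities of \<open>p\<close> in \<open>s\<close> and of \<open>q\<close> in \<open>s'\<close>. Equivalently, the pattern of \<open>p\<close> and \<open>q\<close> equals that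
  of the merged serpent and the short serpent \<open>{s, s'}\<close>.
\<close>

lemma merge_serpents:
  assumes adj: "adjacent_via n Q e s s'"
    and p: "serpent n Q {s, t}" "e \<in> cuts {s, t}" "t \<noteq> s'"
    and q: "serpent n Q {s', u}" "e \<in> cuts {s', u}" "u \<noteq> s"
  shows "serpent n Q {u, t}"
    and "of_bool (extremity n Q {s, t} v g) + of_bool (extremity n Q {s', u} v g) =
      (of_bool (extremity n Q {u, t} v g) + of_bool (g = e \<and> (v = s \<or> v = s')) :: nat)"
    and "of_bool (passes n Q {s, t} v g h) + of_bool (passes n Q {s', u} v g h) =
      (of_bool (passes n Q {u, t} v g h) :: nat)"
proof -
  have adj': "adjacent_via n Q e s' s" using adj by (simp add: adjacent_via_sym)
  have sq: "s \<in> squares n Q" "s' \<in> squares n Q" "s \<noteq> s'" "e \<in> Q" "e \<in> sides s" "e \<in> sides s'"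
    using adj by (auto simp: adjacent_via_def)
  have p': "t \<in> squares n Q" "card {s, t} = 2" "{s, t} \<subseteq> squares n Q"
    and q': "u \<in> squares n Q" "card {s', u} = 2" "{s', u} \<subseteq> squares n Q"
    using p(1) q(1) by (auto simp: serpent_iff)
  have b_ss': "below e s \<noteq> below e s'" using adjacent_via_below[OF adj] .
  have b_t: "below e t = below e s'" and b_u: "below e u = below e s"
    using p(2) q(2) b_ss' by (auto simp: cuts_pair)
  have ne: "u \<noteq> t" "t \<noteq> s" "u \<noteq> s'" using b_t b_u b_ss' by auto
  have m': "card {u, t} = 2" "{u, t} \<subseteq> squares n Q" using ne p' q' by auto
  have p_side: "below e w = below e s'" if "f \<in> cuts {s, t}" "f \<noteq> e" "w \<in> squares n Q" "f \<in> sides w" for f w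
    using cut_beyond[OF adj p'(1) p(2) that] .
  have q_side: "below e w = below e s" if "f \<in> cuts {s', u}" "f \<noteq> e" "w \<in> squares n Q" "f \<in> sides w" for f w
    using cut_beyond[OF adj' q'(1) q(2) that] .
  \<comment> \<open>A further common edge would be incident to squares on both parts of \<open>e\<close>.\<close>
  have common: "f = e" if "f \<in> cuts {s, t}" "f \<in> cuts {s', u}" for f
  proof (rule ccontr)
    assume "f \<noteq> e"
    have "f \<in> Q" using that by (simp add: cuts_pair)
    then obtain v w where vw: "adjacent_via n Q f v w" using edge_squares by metis
    then have "v \<in> squares n Q" "f \<in> sides v" by (auto simp: adjacent_via_def)
    then show False using p_side[OF that(1) \<open>f \<noteq> e\<close>] q_side[OF that(2) \<open>f \<noteq> e\<close>] b_ss' by blast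
  qed
  have m_cuts: "f \<in> cuts {u, t} \<longleftrightarrow> f \<in> cuts {s, t} \<or> f \<in> cuts {s', u}" for f
  proof (cases "f = e")
    case True
    then show ?thesis using p(2) q(2) b_ss' b_t b_u sq(4) by (simp add: cuts_pair)
  next
    case False
    show ?thesis
    proof (cases "f \<in> Q")
      case True
      then show ?thesis
        using adjacent_via_below_other[OF adj True False] common[of f] False by (auto simp: cuts_pair)
    qed (simp add: cuts_pair)
  qed
  \<comment> \<open>No square meets \<open>p\<close> and \<open>q\<close> in edges other than \<open>e\<close>, as those of \<open>p\<close> lie on the side of \<open>s'\<close>
    and those of \<open>q\<close> on the side of \<open>s\<close>. So merging creates no new turn.\<close>
  have no_mix: "f \<in> cuts {s, t} \<and> g \<in> cuts {s, t} \<or> f \<in> cuts {s', u} \<and> g \<in> cuts {s', u}"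
    if "f \<in> cuts {u, t}" "g \<in> cuts {u, t}" "f \<in> sides w" "g \<in> sides w" "w \<in> squares n Q" for f g w
    using that p_side[of f w] q_side[of f w] p_side[of g w] q_side[of g w] p(2) q(2) b_ss'
    unfolding m_cuts by metis
  have "\<not> opposite_sides w f g" if "w \<in> squares n Q" "f \<in> cuts {u, t}" "g \<in> cuts {u, t}" for w f g
  proof
    assume opp: "opposite_sides w f g"
    then have "f \<in> sides w" "g \<in> sides w" by (auto simp: opposite_sides_def)
    then show False using no_mix[OF that(2,3) _ _ that(1)] opp p(1) q(1) that(1)
      unfolding serpent_iff by blast
  qed
  then show "serpent n Q {u, t}" unfolding serpent_iff using m' by blast
  note ext = extremity_iff[OF p'(3,2)] extremity_iff[OF q'(3,2)] extremity_iff[OF m'(2,1)]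
  show "of_bool (extremity n Q {s, t} v g) + of_bool (extremity n Q {s', u} v g) =
      (of_bool (extremity n Q {u, t} v g) + of_bool (g = e \<and> (v = s \<or> v = s')) :: nat)"
  proof -
    consider "v = s" | "v = s'" | "v = t" | "v = u" | "v \<notin> {s, s', t, u}" by blast
    then show ?thesis
    proof cases
      case 1
      have "extremity n Q {s, t} s g \<longleftrightarrow> g = e"
        unfolding ext using p(2) sq p_side[of g s] b_ss' by auto
      moreover have "\<not> extremity n Q {s', u} s g" "\<not> extremity n Q {u, t} s g"
        unfolding ext using sq(3) q(3) ne by auto
      ultimately show ?thesis using 1 by simp
    next
      case 2
      have "extremity n Q {s', u} s' g \<longleftrightarrow> g = e"
        unfolding ext using q(2) sq q_side[of g s'] b_ss' by auto
      moreover have "\<not> extremity n Q {s, t} s' g" "\<not> extremity n Q {u, t} s' g"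
        unfolding ext using sq(3) p(3) ne by auto
      ultimately show ?thesis using 2 by simp
    next
      case 3
      have "g \<in> cuts {s, t}" if "g \<in> cuts {s', u}" "g \<in> sides t"
        using q_side[OF that(1) _ p'(1) that(2)] b_t b_ss' p(2) by blast
      then have "extremity n Q {s, t} t g \<longleftrightarrow> extremity n Q {u, t} t g"
        unfolding ext m_cuts by blast
      moreover have "\<not> extremity n Q {s', u} t g" unfolding ext using p(3) ne by auto
      ultimately show ?thesis using 3 ne p(3) by simp
    next
      case 4
      have "g \<in> cuts {s', u}" if "g \<in> cuts {s, t}" "g \<in> sides u"
        using p_side[OF that(1) _ q'(1) that(2)] b_u b_ss' q(2) by blast
      then have "extremity n Q {s', u} u g \<longleftrightarrow> extremity n Q {u, t} u g"
        unfolding ext m_cuts by blast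
      moreover have "\<not> extremity n Q {s, t} u g" unfolding ext using q(3) ne by auto
      ultimately show ?thesis using 4 ne q(3) by simp
    next
      case 5
      then show ?thesis unfolding ext by simp
    qed
  qed
  note pass = passes_iff[OF p'(3,2)] passes_iff[OF q'(3,2)] passes_iff[OF m'(2,1)]
  have "passes n Q {u, t} v g h \<longleftrightarrow> passes n Q {s, t} v g h \<or> passes n Q {s', u} v g h"
    unfolding pass using no_mix[of g h v] m_cuts by blast
  moreover have "\<not> (passes n Q {s, t} v g h \<and> passes n Q {s', u} v g h)"
    unfolding pass using common by blast
  ultimately show "of_bool (passes n Q {s, t} v g h) + of_bool (passes n Q {s', u} v g h) =
      (of_bool (passes n Q {u, t} v g h) :: nat)"
    by auto
qed

lemma short_serpent:
  assumes adj: "adjacent_via n Q e s s'"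
  shows "serpent n Q {s, s'}" "extremity n Q {s, s'} v g \<longleftrightarrow> g = e \<and> (v = s \<or> v = s')"
    "\<not> passes n Q {s, s'} v g h"
proof -
  have sq: "{s, s'} \<subseteq> squares n Q" "card {s, s'} = 2" and e: "e \<in> Q" "e \<in> sides s" "e \<in> sides s'"
    using adj by (auto simp: adjacent_via_def)
  have cuts: "cuts {s, s'} = {e}"
    using adjacent_via_below[OF adj] adjacent_via_below_other[OF adj] e by (auto simp: cuts_pair)
  show "serpent n Q {s, s'}" unfolding serpent_iff cuts using sq opposite_sides_distinct by auto
  show "extremity n Q {s, s'} v g \<longleftrightarrow> g = e \<and> (v = s \<or> v = s')"
    unfolding extremity_iff[OF sq] cuts using e by auto
  show "\<not> passes n Q {s, s'} v g h" unfolding passes_iff[OF sq] cuts by auto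
qed

lemma serpent_set_finite:
  assumes "\<And>p. p \<in> S \<Longrightarrow> serpent n Q p"
  shows "finite S"
proof (rule finite_subset)
  show "S \<subseteq> Pow (squares n Q)" using assms serpent_iff by blast
qed (use finite_squares in simp)

text \<open>
  In this form the extremity condition depends on the pattern only.
\<close>

lemma nest_sets_iff:
  "S \<in> nest_sets n Q \<longleftrightarrow> (\<forall>p\<in>S. serpent n Q p) \<and> (\<forall>s e. stops n Q S s e \<le> 1)"
proof (cases "\<forall>p\<in>S. serpent n Q p")
  case True
  then have "finite S" using serpent_set_finite by blast
  then have le1: "stops n Q S s e \<le> 1 \<longleftrightarrow>
    (\<forall>p\<in>S. \<forall>q\<in>S. extremity n Q p s e \<longrightarrow> extremity n Q q s e \<longrightarrow> p = q)" for s e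
    unfolding stops_def One_nat_def by (subst card_le_Suc0_iff_eq) auto
  have "S \<in> nest_sets n Q \<longleftrightarrow>
    (\<forall>p\<in>S. \<forall>q\<in>S. \<forall>s e. p \<noteq> q \<longrightarrow> \<not> (extremity n Q p s e \<and> extremity n Q q s e))"
    using True by (simp add: nest_sets_def)
  also have "\<dots> \<longleftrightarrow> (\<forall>s e. stops n Q S s e \<le> 1)" unfolding le1 by blast
  finally show ?thesis using True by simp
qed (auto simp: nest_sets_def)

lemma stops_insert:
  assumes "finite S" "p \<notin> S"
  shows "stops n Q (insert p S) s e = of_bool (extremity n Q p s e) + stops n Q S s e"
proof -
  have "{q \<in> insert p S. extremity n Q q s e} =
    (if extremity n Q p s e then insert p {q \<in> S. extremity n Q q s e} else {q \<in> S. extremity n Q q s e})"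
    by auto
  then show ?thesis unfolding stops_def using assms by simp
qed

lemma turns_insert:
  assumes "finite S" "p \<notin> S"
  shows "turns n Q (insert p S) s e f = of_bool (passes n Q p s e f) + turns n Q S s e f"
proof -
  have "{q \<in> insert p S. passes n Q q s e f} =
    (if passes n Q p s e f then insert p {q \<in> S. passes n Q q s e f} else {q \<in> S. passes n Q q s e f})"
    by auto
  then show ?thesis unfolding turns_def using assms by simp
qed

lemma stops_posE:
  assumes "stops n Q S s e > 0"
  obtains p where "p \<in> S" "extremity n Q p s e"
  using assms unfolding stops_def card_gt_0_iff by blast

section \<open>Existence of the dual nest\<close>

definition dual_stops :: "nat \<Rightarrow> nat \<Rightarrow> nat" where
  "dual_stops a b = (if a > 0 \<and> b > 0 then a - 1 else if a = 0 \<and> b = 0 then a + 1 else a)"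

text \<open>
  If the two extremities belong to one serpent, it is the short serpent \<open>{s, s'}\<close>, which is deleted.
  Otherwise the two serpents are replaced by the merged one. The latter is not yet present: it has
  the extremity of \<open>p\<close> in \<open>t\<close>, and \<open>p\<close> is the only serpent of the set with that extremity.
\<close>

lemma remove_facing_extremities:
  assumes S: "S \<in> nest_sets n Q" and adj: "adjacent_via n Q e s s'"
    and pos: "stops n Q S s e > 0" "stops n Q S s' e > 0"
  shows "\<exists>T. (\<forall>r\<in>T. serpent n Q r) \<and>
    (\<forall>v g. stops n Q S v g = stops n Q T v g + of_bool (g = e \<and> (v = s \<or> v = s'))) \<and>
    (\<forall>v g h. turns n Q S v g h = turns n Q T v g h)"
proof -
  have serp: "serpent n Q r" if "r \<in> S" for r using S that by (simp add: nest_sets_iff)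
  then have finS: "finite S" using serpent_set_finite by blast
  have eq: "r = r'" if "r \<in> S" "r' \<in> S" "extremity n Q r v g" "extremity n Q r' v g" for r r' v g
    using S that unfolding nest_sets_def by blast
  show ?thesis
  proof (cases "{s, s'} \<in> S")
    case True
    define S0 where "S0 = S - {{s, s'}}"
    have S0: "S = insert {s, s'} S0" "{s, s'} \<notin> S0" "finite S0" using True finS by (auto simp: S0_def)
    have "stops n Q S v g = stops n Q S0 v g + of_bool (g = e \<and> (v = s \<or> v = s'))" for v g
      unfolding S0(1) stops_insert[OF S0(3,2)] short_serpent(2)[OF adj] by simp
    moreover have "turns n Q S v g h = turns n Q S0 v g h" for v g h
      unfolding S0(1) turns_insert[OF S0(3,2)] using short_serpent(3)[OF adj] by simp
    ultimately show ?thesis using serp by (intro exI[of _ S0]) (simp add: S0_def)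
  next
    case False
    obtain p where p: "p \<in> S" "extremity n Q p s e" using pos(1) by (rule stops_posE)
    obtain q where q: "q \<in> S" "extremity n Q q s' e" using pos(2) by (rule stops_posE)
    obtain t where t: "p = {s, t}" using p(2) by (auto simp: extremity_def)
    obtain u where u: "q = {s', u}" using q(2) by (auto simp: extremity_def)
    have tu: "t \<noteq> s'" "u \<noteq> s" using False p q t u by (auto simp: insert_commute)
    have sp: "serpent n Q {s, t}" and sq: "serpent n Q {s', u}" using serp p q t u by auto
    have ext: "extremity n Q r v g \<longleftrightarrow> v \<in> r \<and> g \<in> cuts r \<and> g \<in> sides v" if "serpent n Q r" for r v g
      using that extremity_iff unfolding serpent_iff by blast
    have ep: "e \<in> cuts {s, t}" and eq': "e \<in> cuts {s', u}"
      using p(2) q(2) ext[OF sp] ext[OF sq] t u by auto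
    note merged = merge_serpents[OF adj sp ep tu(1) sq eq' tu(2)]
    define S0 where "S0 = S - {p, q}"
    have ss': "s \<noteq> s'" using adj by (simp add: adjacent_via_def)
    have pq: "p \<noteq> q" using t u tu ss' by (auto simp: doubleton_eq_iff)
    have S0: "S = insert p (insert q S0)" "q \<notin> S0" "p \<notin> insert q S0" "finite S0" "finite (insert q S0)"
      using p q pq finS by (auto simp: S0_def)
    have m: "{u, t} \<notin> S0"
    proof
      assume m: "{u, t} \<in> S0"
      have tsq: "s \<in> squares n Q" "t \<in> squares n Q" "s \<noteq> t" using sp by (auto simp: serpent_iff)
      obtain g where g: "g \<in> Q" "g \<in> sides t" "below g t \<noteq> below g s"
        using separating_side[OF tsq(2,1)] tsq(3) by metis
      then have g_ext: "extremity n Q {s, t} t g" unfolding ext[OF sp] by (auto simp: cuts_pair)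
      have "t \<noteq> s \<and> t \<noteq> s'" using tsq tu by blast
      then have "extremity n Q {u, t} t g"
        using merged(2)[of t g] g_ext by (auto split: if_splits simp: of_bool_def)
      then have "{u, t} = p" using eq[of "{u, t}" p t g] m p(1) t g_ext by (simp add: S0_def)
      then show False using m by (simp add: S0_def)
    qed
    have "stops n Q S v g = stops n Q (insert {u, t} S0) v g + of_bool (g = e \<and> (v = s \<or> v = s'))" for v g
      unfolding S0(1) stops_insert[OF S0(5,3)] stops_insert[OF S0(4,2)] stops_insert[OF S0(4) m]
      using merged(2)[of v g] t u by simp
    moreover have "turns n Q S v g h = turns n Q (insert {u, t} S0) v g h" for v g h
      unfolding S0(1) turns_insert[OF S0(5,3)] turns_insert[OF S0(4,2)] turns_insert[OF S0(4) m]
      using merged(3)[of v g h] t u by simp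
    moreover have "\<forall>r\<in>insert {u, t} S0. serpent n Q r" using serp merged(1) by (simp add: S0_def)
    ultimately show ?thesis by blast
  qed
qed

text \<open>
  Exactly one of the three cases of the duality rule applies at \<open>e\<close>: facing extremities are removed,
  a short serpent is added, or nothing is done.
\<close>

lemma dualize_edge:
  assumes S: "S \<in> nest_sets n Q" and e: "e \<in> Q"
  shows "\<exists>T\<in>nest_sets n Q.
    (\<forall>v v'. adjacent_via n Q e v v' \<longrightarrow> stops n Q T v e = dual_stops (stops n Q S v e) (stops n Q S v' e)) \<and>
    (\<forall>v g. g \<noteq> e \<longrightarrow> stops n Q T v g = stops n Q S v g) \<and>
    (\<forall>v g h. turns n Q T v g h = turns n Q S v g h)"
proof -
  obtain s s' where adj: "adjacent_via n Q e s s'" using edge_squares[OF e] by metis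
  have pair: "v = s \<and> v' = s' \<or> v = s' \<and> v' = s" if "adjacent_via n Q e v v'" for v v'
    using that incident_squares[OF adj, of v] incident_squares[OF adj, of v']
    by (auto simp: adjacent_via_def)
  have serp: "serpent n Q r" if "r \<in> S" for r using S that by (simp add: nest_sets_iff)
  then have finS: "finite S" using serpent_set_finite by blast
  have le1: "stops n Q S v g \<le> 1" for v g using S by (simp add: nest_sets_iff)
  consider "stops n Q S s e > 0 \<and> stops n Q S s' e > 0" | "stops n Q S s e = 0 \<and> stops n Q S s' e = 0"
    | "(stops n Q S s e > 0) \<noteq> (stops n Q S s' e > 0)" by linarith
  then show ?thesis
  proof cases
    case 1
    then obtain T where T: "\<forall>r\<in>T. serpent n Q r"
      "\<And>v g. stops n Q S v g = stops n Q T v g + of_bool (g = e \<and> (v = s \<or> v = s'))"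
      "\<And>v g h. turns n Q S v g h = turns n Q T v g h"
      using remove_facing_extremities[OF S adj] by blast
    have "stops n Q T v g \<le> 1" for v g using le1[of v g] T(2)[of v g] by linarith
    then have "T \<in> nest_sets n Q" using T(1) by (simp add: nest_sets_iff)
    moreover have "stops n Q T v e = dual_stops (stops n Q S v e) (stops n Q S v' e)"
      if "adjacent_via n Q e v v'" for v v'
      using pair[OF that] 1 T(2)[of v e] by (auto simp: dual_stops_def)
    moreover have "stops n Q T v g = stops n Q S v g" if "g \<noteq> e" for v g
      using T(2)[of v g] that by simp
    ultimately show ?thesis using T(3) by (intro bexI[of _ T]) simp_all
  next
    case 2
    define T where "T = insert {s, s'} S"
    have not_in: "{s, s'} \<notin> S"
    proof
      assume *: "{s, s'} \<in> S"
      have "finite (S - {{s, s'}})" using finS by simp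
      moreover have "S = insert {s, s'} (S - {{s, s'}})" using * by blast
      ultimately have "stops n Q S s e > 0"
        using stops_insert[of "S - {{s, s'}}" "{s, s'}" s e] short_serpent(2)[OF adj, of s e] by simp
      then show False using 2 by simp
    qed
    have T: "stops n Q T v g = of_bool (g = e \<and> (v = s \<or> v = s')) + stops n Q S v g" for v g
      unfolding T_def stops_insert[OF finS not_in] short_serpent(2)[OF adj] by simp
    have "turns n Q T v g h = turns n Q S v g h" for v g h
      unfolding T_def turns_insert[OF finS not_in] using short_serpent(3)[OF adj] by simp
    moreover have "stops n Q T v g \<le> 1" for v g
      using le1[of v g] T[of v g] 2 by (cases "g = e \<and> (v = s \<or> v = s')") auto
    then have "T \<in> nest_sets n Q"
      using serp short_serpent(1)[OF adj] by (simp add: nest_sets_iff T_def)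
    moreover have "stops n Q T v e = dual_stops (stops n Q S v e) (stops n Q S v' e)"
      if "adjacent_via n Q e v v'" for v v'
      using pair[OF that] 2 T[of v e] by (auto simp: dual_stops_def)
    moreover have "stops n Q T v g = stops n Q S v g" if "g \<noteq> e" for v g
      using T[of v g] that by simp
    ultimately show ?thesis by (intro bexI[of _ T]) simp_all
  next
    case 3
    then have "stops n Q S v e = dual_stops (stops n Q S v e) (stops n Q S v' e)"
      if "adjacent_via n Q e v v'" for v v'
      using pair[OF that] by (auto simp: dual_stops_def)
    then show ?thesis using S by (intro bexI[of _ S]) auto
  qed
qed

text \<open>
  The rule for an edge reads and changes only the extremities at that edge, so the edges can be
  treated one after the other.
\<close>

lemma dualize_edges:
  assumes S: "S \<in> nest_sets n Q" and "finite D" "D \<subseteq> Q"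
  shows "\<exists>T\<in>nest_sets n Q.
    (\<forall>e\<in>D. \<forall>v v'. adjacent_via n Q e v v' \<longrightarrow>
      stops n Q T v e = dual_stops (stops n Q S v e) (stops n Q S v' e)) \<and>
    (\<forall>v g. g \<notin> D \<longrightarrow> stops n Q T v g = stops n Q S v g) \<and>
    (\<forall>v g h. turns n Q T v g h = turns n Q S v g h)"
  using assms(2,3)
proof (induction D rule: finite_induct)
  case empty
  then show ?case using S by (intro bexI[of _ S]) auto
next
  case (insert e D)
  then obtain T where T: "T \<in> nest_sets n Q"
    "\<And>f v v'. f \<in> D \<Longrightarrow> adjacent_via n Q f v v' \<Longrightarrow>
      stops n Q T v f = dual_stops (stops n Q S v f) (stops n Q S v' f)"
    "\<And>v g. g \<notin> D \<Longrightarrow> stops n Q T v g = stops n Q S v g"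
    "\<And>v g h. turns n Q T v g h = turns n Q S v g h" by auto
  obtain T' where T': "T' \<in> nest_sets n Q"
    "\<And>v v'. adjacent_via n Q e v v' \<Longrightarrow>
      stops n Q T' v e = dual_stops (stops n Q T v e) (stops n Q T v' e)"
    "\<And>v g. g \<noteq> e \<Longrightarrow> stops n Q T' v g = stops n Q T v g"
    "\<And>v g h. turns n Q T' v g h = turns n Q T v g h"
    using dualize_edge[OF T(1), of e] insert.prems by auto
  have "stops n Q T' v f = dual_stops (stops n Q S v f) (stops n Q S v' f)"
    if "f \<in> insert e D" "adjacent_via n Q f v v'" for f v v'
  proof (cases "f = e")
    case True
    then show ?thesis using T'(2) T(3)[OF insert.hyps(2)] that by simp
  next
    case False
    then show ?thesis using T'(3) T(2) that by simp
  qed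
  moreover have "stops n Q T' v g = stops n Q S v g" if "g \<notin> insert e D" for v g
    using T'(3) T(3) that by simp
  ultimately show ?case using T'(1,4) T(4) by (intro bexI[of _ T']) auto
qed

lemma dual_pattern_iff:
  "dual_pattern n Q S T \<longleftrightarrow>
     (\<forall>e s s'. adjacent_via n Q e s s' \<longrightarrow> stops n Q T s e = dual_stops (stops n Q S s e) (stops n Q S s' e)) \<and>
     (\<forall>s\<in>squares n Q.
        (\<forall>e\<in>sides s - Q. stops n Q T s e = stops n Q S s e) \<and>
        (\<forall>e f. adjacent_sides s e f \<longrightarrow> turns n Q T s e f = turns n Q S s e f))"
  unfolding dual_pattern_def dual_stops_def by simp

lemma dual_exists:
  assumes "S \<in> nest_sets n Q"
  shows "\<exists>T\<in>nest_sets n Q. dual_pattern n Q S T"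
proof -
  obtain T where T: "T \<in> nest_sets n Q"
    "\<And>e v v'. e \<in> Q \<Longrightarrow> adjacent_via n Q e v v' \<Longrightarrow>
      stops n Q T v e = dual_stops (stops n Q S v e) (stops n Q S v' e)"
    "\<And>v g. g \<notin> Q \<Longrightarrow> stops n Q T v g = stops n Q S v g"
    "\<And>v g h. turns n Q T v g h = turns n Q S v g h"
    using dualize_edges[OF assms finite_Q] by auto
  have "e \<in> Q" if "adjacent_via n Q e v v'" for e v v' using that by (simp add: adjacent_via_def)
  then have "dual_pattern n Q S T" unfolding dual_pattern_iff using T(2-4) by auto
  then show ?thesis using T(1) by blast
qed

section \<open>Rank and duality\<close>

definition incidences :: "(edge \<times> square) set" where
  "incidences = (SIGMA e:Q. {s \<in> squares n Q. e \<in> sides s})"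

lemma finite_incidences: "finite incidences"
  unfolding incidences_def using finite_Q finite_squares by auto

lemma two_extremities:
  assumes "serpent n Q p"
  shows "card {x \<in> incidences. extremity n Q p (snd x) (fst x)} = 2"
proof -
  have p: "p \<subseteq> squares n Q" "card p = 2" using assms by (auto simp: serpent_iff)
  let ?X = "{x \<in> incidences. extremity n Q p (snd x) (fst x)}"
  have partner: "\<exists>t. p = {s, t} \<and> s \<noteq> t" if "s \<in> p" for s using p(2) that by (auto simp: card_2_iff)
  have X: "?X = {(e, s). s \<in> p \<and> e \<in> cuts p \<and> e \<in> sides s}"
    unfolding extremity_iff[OF p] incidences_def using p(1) cuts_subset by auto
  have "bij_betw snd ?X p"
    unfolding X bij_betw_def
  proof
    show "inj_on snd {(e, s). s \<in> p \<and> e \<in> cuts p \<and> e \<in> sides s}"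
    proof (rule inj_onI, clarsimp)
      fix e f s assume *: "s \<in> p" "e \<in> cuts p" "f \<in> cuts p" "e \<in> sides s" "f \<in> sides s"
      obtain t where "p = {s, t}" using partner[OF *(1)] by blast
      then show "e = f" using serpent_end_edge_unique[of s t e f] * p(1) by auto
    qed
    show "snd ` {(e, s). s \<in> p \<and> e \<in> cuts p \<and> e \<in> sides s} = p"
    proof
      show "p \<subseteq> snd ` {(e, s). s \<in> p \<and> e \<in> cuts p \<and> e \<in> sides s}"
      proof
        fix s assume s: "s \<in> p"
        obtain t where t: "p = {s, t}" "s \<noteq> t" using partner[OF s] by blast
        then have "s \<in> squares n Q" "t \<in> squares n Q" using p(1) by auto
        then obtain e where "e \<in> Q" "e \<in> sides s" "below e s \<noteq> below e t"
          using separating_side t(2) by metis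
        then have "(e, s) \<in> {(e, s). s \<in> p \<and> e \<in> cuts p \<and> e \<in> sides s}"
          using t(1) by (simp add: cuts_pair)
        then show "s \<in> snd ` {(e, s). s \<in> p \<and> e \<in> cuts p \<and> e \<in> sides s}" by force
      qed
    qed auto
  qed
  from bij_betw_same_card[OF this] show ?thesis using p(2) by simp
qed

text \<open>
  Every serpent has two extremities, each leaving its square through one edge. Hence the pattern
  determines the rank.
\<close>

lemma card_nest_set:
  assumes "S \<in> nest_sets n Q"
  shows "2 * card S = (\<Sum>(e, s)\<in>incidences. stops n Q S s e)"
proof -
  have serp: "\<forall>p\<in>S. serpent n Q p" using assms by (simp add: nest_sets_iff)
  then have "finite S" using serpent_set_finite by blast
  then have "(\<Sum>x\<in>incidences. card {p \<in> S. extremity n Q p (snd x) (fst x)}) = 2 * card S"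
    using serp two_extremities by (intro sum_multicount finite_incidences) auto
  then show ?thesis by (simp add: stops_def case_prod_beta)
qed

lemma same_pattern_card:
  assumes "(S, T) \<in> same_pattern n Q"
  shows "card S = card T"
proof -
  have "S \<in> nest_sets n Q" "T \<in> nest_sets n Q"
    "\<And>e s. s \<in> squares n Q \<Longrightarrow> e \<in> sides s \<Longrightarrow> stops n Q S s e = stops n Q T s e"
    using assms by (auto simp: same_pattern_def)
  moreover from this(3) have "(\<Sum>(e, s)\<in>incidences. stops n Q S s e) = (\<Sum>(e, s)\<in>incidences. stops n Q T s e)"
    by (intro sum.cong) (auto simp: incidences_def)
  ultimately have "2 * card S = 2 * card T" using card_nest_set by simp
  then show ?thesis by simp
qed

lemma nest_rank_class:
  assumes "S \<in> nest_sets n Q"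
  shows "nest_rank (same_pattern n Q `` {S}) = card S"
proof -
  have "S \<in> same_pattern n Q `` {S}" using assms by (simp add: same_pattern_def)
  moreover have "card T = card S" if "T \<in> same_pattern n Q `` {S}" for T
    using same_pattern_card[of S T] that by simp
  ultimately have "card ` (same_pattern n Q `` {S}) = {card S}" by blast
  then show ?thesis by (simp add: nest_rank_def)
qed

text \<open>
  At each inner edge the numbers of extremities of \<open>S\<close> and of \<open>T\<close> add up to two: duality replaces
  two extremities by none, none by two, and keeps a single one. With \<open>n - 1\<close> inner edges this makes
  \<open>2 (n - 1)\<close> extremities in total, two for each serpent.
\<close>

lemma dual_card:
  assumes S: "S \<in> nest_sets n Q" and T: "T \<in> nest_sets n Q" and dual: "dual_pattern n Q S T"
  shows "card S + card T = n - 1"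
proof -
  let ?f = "\<lambda>e s. stops n Q S s e + stops n Q T s e"
  have "2 * (card S + card T) = (\<Sum>(e, s)\<in>incidences. ?f e s)"
    using card_nest_set[OF S] card_nest_set[OF T] by (simp add: sum.distrib case_prod_beta)
  also have "\<dots> = (\<Sum>e\<in>Q. \<Sum>s\<in>{s \<in> squares n Q. e \<in> sides s}. ?f e s)"
    unfolding incidences_def using finite_Q finite_squares by (subst sum.Sigma) auto
  also have "\<dots> = (\<Sum>e\<in>Q. 2)"
  proof (rule sum.cong[OF refl])
    fix e assume "e \<in> Q"
    then obtain s s' where adj: "adjacent_via n Q e s s'" using edge_squares by metis
    have "s \<noteq> s'" and eq: "{s \<in> squares n Q. e \<in> sides s} = {s, s'}"
      using adj incident_squares[OF adj] by (auto simp: adjacent_via_def)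
    moreover have "stops n Q T s e = dual_stops (stops n Q S s e) (stops n Q S s' e)"
      "stops n Q T s' e = dual_stops (stops n Q S s' e) (stops n Q S s e)"
      using dual adj adjacent_via_sym unfolding dual_pattern_iff by blast+
    moreover have "stops n Q S s e \<le> 1" "stops n Q S s' e \<le> 1"
      using S by (simp_all add: nest_sets_iff)
    ultimately show "(\<Sum>s\<in>{s \<in> squares n Q. e \<in> sides s}. ?f e s) = 2"
      unfolding eq by (auto simp: dual_stops_def)
  qed
  finally show ?thesis using card_squares_card_Q(2) by simp
qed

text \<open>
  The duality rule is a function of the pattern, so every dual of a set equivalent to \<open>S\<close> has the
  pattern of \<open>T\<close>; conversely every set with the pattern of \<open>T\<close> is a dual of \<open>S\<close>.
\<close>

lemma nest_dual_class:
  assumes S: "S \<in> nest_sets n Q" and T: "T \<in> nest_sets n Q" and dual: "dual_pattern n Q S T"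
  shows "nest_dual n Q (same_pattern n Q `` {S}) = same_pattern n Q `` {T}"
proof (rule set_eqI)
  fix U
  have pattern_eq: "(T, U) \<in> same_pattern n Q"
    if S': "(S, S') \<in> same_pattern n Q" and U: "U \<in> nest_sets n Q" "dual_pattern n Q S' U" for S'
  proof -
    have SS: "stops n Q S s e = stops n Q S' s e" if "s \<in> squares n Q" "e \<in> sides s" for s e
      using S' that by (auto simp: same_pattern_def)
    have "stops n Q T s e = stops n Q U s e" if s: "s \<in> squares n Q" "e \<in> sides s" for s e
    proof (cases "e \<in> Q")
      case True
      then obtain s' where adj: "adjacent_via n Q e s s'" using neighbour_exists s by metis
      then have "s' \<in> squares n Q" "e \<in> sides s'" by (auto simp: adjacent_via_def)
      then show ?thesis using adj dual U(2) SS[OF s] SS unfolding dual_pattern_iff by metis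
    next
      case False
      then show ?thesis using dual U(2) SS[OF s] s unfolding dual_pattern_iff by simp
    qed
    moreover have "turns n Q T s e f = turns n Q U s e f" if "s \<in> squares n Q" "adjacent_sides s e f" for s e f
      using dual U(2) S' that unfolding dual_pattern_iff same_pattern_def by simp
    ultimately show ?thesis using T U(1) by (simp add: same_pattern_def)
  qed
  have "dual_pattern n Q S U" if "(T, U) \<in> same_pattern n Q"
    using that dual unfolding dual_pattern_iff same_pattern_def adjacent_via_def by auto
  moreover have "(S, S) \<in> same_pattern n Q" using S by (simp add: same_pattern_def)
  moreover have "U \<in> nest_sets n Q" if "(T, U) \<in> same_pattern n Q" using that by (simp add: same_pattern_def)
  ultimately show "U \<in> nest_dual n Q (same_pattern n Q `` {S}) \<longleftrightarrow> U \<in> same_pattern n Q `` {T}"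
    unfolding nest_dual_def using pattern_eq by blast
qed

end

theorem proposition4p3:
  fixes n :: nat and Q :: "edge set" and \<sigma> :: serpent_nest
  assumes "quadrangulation n Q"
    and "\<sigma> \<in> serpent_nests n Q"
  shows "card (squares n Q) = n \<and> card Q = n - 1 \<and>
    nest_dual n Q \<sigma> \<in> serpent_nests n Q \<and>
    int (nest_rank (nest_dual n Q \<sigma>)) = int n - 1 - int (nest_rank \<sigma>)"
proof -
  interpret polygon_quadrangulation n Q by unfold_locales (rule assms(1))
  obtain S where S: "S \<in> nest_sets n Q" "\<sigma> = same_pattern n Q `` {S}"
    using assms(2) unfolding serpent_nests_def by (rule quotientE)
  obtain T where T: "T \<in> nest_sets n Q" "dual_pattern n Q S T" using dual_exists[OF S(1)] by blast
  have dual: "nest_dual n Q \<sigma> = same_pattern n Q `` {T}"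
    unfolding S(2) by (rule nest_dual_class[OF S(1) T])
  then have "nest_dual n Q \<sigma> \<in> serpent_nests n Q"
    unfolding serpent_nests_def using T(1) by (simp add: quotientI)
  moreover have "nest_rank \<sigma> + nest_rank (nest_dual n Q \<sigma>) = n - 1"
    unfolding dual unfolding S(2) nest_rank_class[OF S(1)] nest_rank_class[OF T(1)]
    by (rule dual_card[OF S(1) T])
  ultimately show ?thesis using card_squares_card_Q n_pos by linarith
qed

end
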